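(* For all $0\le t\le1$, the quadrature identity $$\int_{\mathbb{C}}h(z)g_t(z)\,dx\,dy=2\pi\big(h(-1)+h(1)\big)$$ holds for all functions $h$ which are harmonic over (i.e. in a neighborhood of) the support of $g_t$.
   Context: $z=x+iy$. Let $$Q(z,z)=\big(|z-1|^2-2\big)\big(|z+1|^2-2\big)=z^2\overline{z}^2-4z\overline{z}-z^2-\overline{z}^2+1,$$ and for real $t$ let $\Omega(t)=\{z\in\mathbb{C}:Q(z,z)<t\}$. For $0<t<1$, $\Omega(t)$ is a smoothly bounded doubly connected domain; the "hole" is the bounded component of $\mathbb{C}\setminus\Omega(t)$. The density function $g_t$ is defined by $g_t=1$ in $\Omega(t)$, $g_t=2$ in the hole, and $g_t=0$ elsewhere. For $t=0$, $g_0=\chi_{\mathbb{D}(-1,\sqrt2)}+\chi_{\mathbb{D}(1,\sqrt2)}$, where $\mathbb{D}(a,r)$ is the disk of center $a$ and radius $r$ (the hole being the intersection of the two disks). For $t=1$, the hole reduces to the single point $\{0\}$, which is ignored, and $g_1=\chi_{\Omega(1)}$. *)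

theory Defs
  imports "HOL-Analysis.Analysis"
begin

text \<open>The diagonal values \<open>Q(z,z)\<close>, which are real.\<close>
definition Q_diag :: "complex \<Rightarrow> real" where
  "Q_diag z = ((cmod (z - 1))\<^sup>2 - 2) * ((cmod (z + 1))\<^sup>2 - 2)"

lemma Q_diag_expand:
  "complex_of_real (Q_diag z) = z\<^sup>2 * (cnj z)\<^sup>2 - 4 * z * cnj z - z\<^sup>2 - (cnj z)\<^sup>2 + 1"
proof -
  have *: "complex_of_real ((cmod w)\<^sup>2) = w * cnj w" for w
    by (metis complex_norm_square)
  show ?thesis
    unfolding Q_diag_def of_real_mult of_real_diff *
    by (simp add: algebra_simps power2_eq_square)
qed

definition \<Omega> :: "real \<Rightarrow> complex set" where
  "\<Omega> t = {z. Q_diag z < t}"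

text \<open>\<open>inside S\<close> is the union of the bounded connected components of the complement of \<open>S\<close>.
  For \<open>0 < t < 1\<close> the complement of \<open>\<Omega> t\<close> has exactly one such component.\<close>
definition hole :: "real \<Rightarrow> complex set" where
  "hole t = inside (\<Omega> t)"

text \<open>The endpoint cases are stipulated separately: for \<open>t = 0\<close> the two open disks overlap in a
  lens, which touches the unbounded part of the complement of \<open>\<Omega> 0\<close> at \<open>\<plusminus>\<i>\<close>, and for \<open>t = 1\<close> the
  one-point hole \<open>{0}\<close> is ignored.\<close>
definition quad_density :: "real \<Rightarrow> complex \<Rightarrow> real" where
  "quad_density t z =
    (if t = 0 then indicator (ball (- 1) (sqrt 2)) z + indicator (ball 1 (sqrt 2)) z
     else if t = 1 then indicator (\<Omega> 1) z
     else if z \<in> \<Omega> t then 1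
     else if z \<in> hole t then 2
     else 0)"

text \<open>Harmonic on an open set \<open>U\<close> of the plane: twice continuously (real) differentiable with
  vanishing Laplacian.  Here \<open>h'\<close> and \<open>h''\<close> are the first and second Frechet derivatives of \<open>h\<close>;
  \<open>h'' z 1 1\<close> and \<open>h'' z \<i> \<i>\<close> are the second partial derivatives in the directions \<open>x\<close> and \<open>y\<close>.\<close>
definition harmonic_on :: "(complex \<Rightarrow> 'a::real_normed_vector) \<Rightarrow> complex set \<Rightarrow> bool" where
  "harmonic_on h U \<longleftrightarrow> open U \<and>
    (\<exists>(h' :: complex \<Rightarrow> complex \<Rightarrow>\<^sub>L 'a) (h'' :: complex \<Rightarrow> complex \<Rightarrow>\<^sub>L (complex \<Rightarrow>\<^sub>L 'a)).
      (\<forall>z\<in>U. (h has_derivative blinfun_apply (h' z)) (at z)) \<and>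
      (\<forall>z\<in>U. (h' has_derivative blinfun_apply (h'' z)) (at z)) \<and>
      continuous_on U h'' \<and>
      (\<forall>z\<in>U. blinfun_apply (blinfun_apply (h'' z) 1) 1
            + blinfun_apply (blinfun_apply (h'' z) \<i>) \<i> = 0))"

end

(* For each direction v the equation Q(x(1+iv)) = t is quadratic in x^2, with product and sum of its
   roots polynomial in 1-t and E, 1/E, where E = (1+iv)/(1-iv) has modulus 1.  Along this line g_t is
   the sum of the indicators of the two intervals cut out by the roots, so the moments of g_t are
   integrals of power sums of the two roots, that is, of Laurent polynomials in E, and these are read
   off from a single coefficient, which does not depend on t.  The moments determine the
   quadrature identity: for f holomorphic near the starlike closed support, the defect of the identity
   for f(lz) is holomorphic in l and all its derivatives at l = 0 are moment identities, so that
   it vanishes at l = 1.  A harmonic h is F + cnj G on a starlike neighbourhood. *)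
theory Submission
  imports Defs "HOL-Complex_Analysis.Complex_Analysis" "HOL-Probability.Sinc_Integral"
begin

text \<open>Put s = |z|^2 on the line of slope v. Then Q(z,z) - t = s^2 - 2 c s + (1 - t) with 2 c =
  4 + E + 1/E. The value 1 always lies strictly between the roots, since the quadratic is negative
  at s = 1. So the smaller interval is the trace of the hole, of the lens for t = 0, and is empty
  for t = 1; the moment integrals then treat all t in [0,1] alike. The parameter t enters only
  through the product 1 - t of the roots. Once denominators are cleared, Newton's recursion
  multiplies this product by E^2, while a moment reads off the coefficient of E^1: this is why the
  moments do not see t. The set Omega(t) is ring-shaped for 0 < t \<le> 1 and does not contain the
  origin. The positive weight in the hole, or the closure when t = 1, fills it in. Only thereby is
  there a starlike set about 0, which both the dilations and the primitive of a holomorphic function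
  rely on.\<close>

subsection \<open>Symmetry of the second derivative\<close>

text \<open>The second difference is symmetric in \<open>a\<close> and \<open>b\<close>, while its leading term is \<open>D b a\<close>.\<close>
lemma second_difference_bound:
  fixes h :: "'a::real_normed_vector \<Rightarrow> 'b::real_normed_vector" and h' :: "'a \<Rightarrow> 'a \<Rightarrow>\<^sub>L 'b"
  assumes D: "linear D"
    and h: "\<And>w. norm (w - z) < d \<Longrightarrow> (h has_derivative blinfun_apply (h' w)) (at w)"
    and R: "\<And>w. norm (w - z) < d \<Longrightarrow> norm (h' w - h' z - D (w - z)) \<le> e * norm (w - z)"
    and s: "0 < s" "s * (norm a + norm b) < d" and e: "0 \<le> e"
  shows "norm (h (z + s *\<^sub>R a + s *\<^sub>R b) - h (z + s *\<^sub>R a) - h (z + s *\<^sub>R b) + h z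
            - (s * s) *\<^sub>R blinfun_apply (D b) a) \<le> 2 * e * (norm a + norm b)\<^sup>2 * s\<^sup>2"
proof -
  define M where "M = norm a + norm b"
  define f where "f = (\<lambda>u. h (z + u *\<^sub>R a + s *\<^sub>R b) - h (z + u *\<^sub>R a) - (u * s) *\<^sub>R blinfun_apply (D b) a)"
  define f' where "f' = (\<lambda>u. blinfun_apply (h' (z + u *\<^sub>R a + s *\<^sub>R b)) a - blinfun_apply (h' (z + u *\<^sub>R a)) a - s *\<^sub>R blinfun_apply (D b) a)"
  have le: "norm (u *\<^sub>R a + v *\<^sub>R b) \<le> s * M" if "u \<in> {0..s}" "v \<in> {0..s}" for u v
  proof -
    have "norm (u *\<^sub>R a + v *\<^sub>R b) \<le> u * norm a + v * norm b"
      using norm_triangle_ineq[of "u *\<^sub>R a" "v *\<^sub>R b"] that by simp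
    also have "\<dots> \<le> s * M"
      using that by (auto simp: M_def distrib_left intro!: add_mono mult_right_mono)
    finally show ?thesis .
  qed
  have sM: "s * M < d" using s by (simp add: M_def)
  have M0: "0 \<le> M" by (simp add: M_def)
  have der: "(f has_derivative (\<lambda>x. x *\<^sub>R f' u)) (at u within {0..s})" if u: "u \<in> {0..s}" for u
  proof -
    have 1: "norm (z + u *\<^sub>R a + s *\<^sub>R b - z) < d" using le[of u s] u s sM by (simp add: add.assoc)
    have 2: "norm (z + u *\<^sub>R a - z) < d" using le[of u 0] u s sM by simp
    have d1: "((\<lambda>u. h (z + u *\<^sub>R a + s *\<^sub>R b)) has_derivative (\<lambda>x. h' (z + u *\<^sub>R a + s *\<^sub>R b) (x *\<^sub>R a))) (at u within {0..s})"
      by (rule has_derivative_compose[where f = "\<lambda>u. z + u *\<^sub>R a + s *\<^sub>R b" and g = h, OF _ h[OF 1]]) (auto intro!: derivative_eq_intros)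
    have d2: "((\<lambda>u. h (z + u *\<^sub>R a)) has_derivative (\<lambda>x. h' (z + u *\<^sub>R a) (x *\<^sub>R a))) (at u within {0..s})"
      by (rule has_derivative_compose[where f = "\<lambda>u. z + u *\<^sub>R a" and g = h, OF _ h[OF 2]]) (auto intro!: derivative_eq_intros)
    show ?thesis unfolding f_def f'_def
      by (rule derivative_eq_intros d1 d2 refl)+ (auto simp: blinfun.scaleR_right algebra_simps)
  qed
  have bnd: "norm (f' u) \<le> 2 * e * M\<^sup>2 * s" if u: "u \<in> {0..s}" for u
  proof -
    let ?v = "u *\<^sub>R a + s *\<^sub>R b" let ?w = "u *\<^sub>R a"
    have v: "norm ?v \<le> s * M" and w: "norm ?w \<le> s * M"
      using le[of u s] le[of u 0] u s by auto
    \<comment> \<open>Both increments contain \<open>u *\<^sub>R a\<close>; linearity cancels it and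
      leaves the \<open>D b\<close> term of \<open>f'\<close>, so that only two remainders of size
      at most \<open>e * (s * M)\<close> survive.\<close>
    have "D ?v - D ?w = s *\<^sub>R D b"
      using D by (simp add: linear_add linear_scale)
    then have "f' u = blinfun_apply ((h' (z + ?v) - h' z - D ?v) - (h' (z + ?w) - h' z - D ?w)) a"
      unfolding f'_def
      by (simp add: blinfun.diff_left blinfun.scaleR_left algebra_simps)
         (metis (no_types, lifting) blinfun.add_left blinfun.scaleR_left diff_eq_eq)
    then have "norm (f' u) \<le> norm ((h' (z + ?v) - h' z - D ?v) - (h' (z + ?w) - h' z - D ?w)) * norm a"
      by (simp add: norm_blinfun)
    also have "\<dots> \<le> (e * norm ?v + e * norm ?w) * norm a"
      using order_trans[OF norm_triangle_ineq4 add_mono[OF R[of "z + ?v"] R[of "z + ?w"]]] v w sM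
      by (intro mult_right_mono) auto
    also have "\<dots> \<le> (e * (s * M) + e * (s * M)) * M"
      using v w e s M0 by (intro mult_mono add_mono mult_left_mono) (auto simp: M_def)
    finally show ?thesis by (simp add: algebra_simps power2_eq_square)
  qed
  have "norm (f s - f 0) \<le> 2 * e * M\<^sup>2 * s * norm (s - 0)"
  proof (rule differentiable_bound[OF convex_closed_interval[of 0 s] der])
    show "onorm (\<lambda>x. x *\<^sub>R f' u) \<le> 2 * e * M\<^sup>2 * s" if "u \<in> {0..s}" for u
      using bnd[OF that] by (simp add: onorm_scaleR_left[OF bounded_linear_ident] onorm_id)
  qed (use s in auto)
  then show ?thesis using s by (simp add: f_def M_def power2_eq_square algebra_simps)
qed

text \<open>Divided by \<open>s\<^sup>2\<close>, one and the same second difference is close to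
  \<open>D b a\<close> and, with \<open>a\<close> and \<open>b\<close> interchanged, to
  \<open>D a b\<close>. The definition of \<open>harmonic_on\<close> does not state this symmetry;
  the Cauchy-Riemann equations for the Wirtinger derivative of \<open>h\<close> depend on
  it.\<close>

lemma second_derivative_symmetric:
  fixes h :: "'a::real_normed_vector \<Rightarrow> 'b::real_normed_vector" and h' :: "'a \<Rightarrow> 'a \<Rightarrow>\<^sub>L 'b"
  assumes "open U" "z \<in> U"
    and h: "\<And>w. w \<in> U \<Longrightarrow> (h has_derivative blinfun_apply (h' w)) (at w)"
    and h': "(h' has_derivative D) (at z)"
  shows "blinfun_apply (D a) b = blinfun_apply (D b) a"
proof -
  have lin: "linear D" using h' by (rule has_derivative_linear)
  define M where "M = norm a + norm b"
  have bound: "norm (blinfun_apply (D a) b - blinfun_apply (D b) a) \<le> 4 * M\<^sup>2 * e" if e: "e > 0" for e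
  proof -
    obtain d1 where d1: "d1 > 0" "\<And>w. norm (w - z) < d1 \<Longrightarrow> norm (h' w - h' z - D (w - z)) \<le> e * norm (w - z)"
      using h' e unfolding has_derivative_at_alt by blast
    obtain d2 where d2: "d2 > 0" "ball z d2 \<subseteq> U" using assms openE by blast
    define d where "d = min d1 d2"
    have d: "d > 0" using d1 d2 by (simp add: d_def)
    have hd: "(h has_derivative blinfun_apply (h' w)) (at w)" if "norm (w - z) < d" for w
      using that d2 by (intro h) (auto simp: d_def ball_def dist_norm norm_minus_commute)
    \<comment> \<open>The summand 1 keeps the division meaningful when \<open>a = b = 0\<close>; in
      every case \<open>s * M \<le> d / 2\<close>.\<close>
    define s where "s = d / (M + 1) / 2"
    have M0: "0 \<le> M" by (simp add: M_def)
    have M1: "M + 1 \<noteq> 0" using M0 by simp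
    have s: "0 < s" using d M0 by (simp add: s_def)
    have sM: "s * M < d"
    proof -
      have "s * M \<le> s * (M + 1)" using s by simp
      also have "\<dots> = d / 2"
        using nonzero_mult_div_cancel_right[OF M1, of "d / 2"] unfolding s_def by (simp add: mult.commute)
      finally show ?thesis using d by linarith
    qed
    let ?X = "h (z + s *\<^sub>R a + s *\<^sub>R b) - h (z + s *\<^sub>R a) - h (z + s *\<^sub>R b) + h z"
    have 1: "norm (?X - (s * s) *\<^sub>R blinfun_apply (D b) a) \<le> 2 * e * M\<^sup>2 * s\<^sup>2"
      unfolding M_def
      by (rule second_difference_bound[where h' = h' and d = d]) (use lin hd d1 s sM e in \<open>auto simp: M_def d_def\<close>)
    have "norm (h (z + s *\<^sub>R b + s *\<^sub>R a) - h (z + s *\<^sub>R b) - h (z + s *\<^sub>R a) + h z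
            - (s * s) *\<^sub>R blinfun_apply (D a) b) \<le> 2 * e * (norm b + norm a)\<^sup>2 * s\<^sup>2"
      by (rule second_difference_bound[where h' = h' and d = d]) (use lin hd d1 s sM e in \<open>auto simp: M_def d_def add.commute\<close>)
    then have 2: "norm (?X - (s * s) *\<^sub>R blinfun_apply (D a) b) \<le> 2 * e * M\<^sup>2 * s\<^sup>2"
      by (simp add: M_def algebra_simps)
    have "norm ((s * s) *\<^sub>R (blinfun_apply (D a) b - blinfun_apply (D b) a)) \<le> 4 * e * M\<^sup>2 * s\<^sup>2"
      using norm_triangle_ineq4[of "?X - (s * s) *\<^sub>R blinfun_apply (D b) a" "?X - (s * s) *\<^sub>R blinfun_apply (D a) b"] 1 2
      by (simp add: scaleR_right_diff_distrib)
    then have "s\<^sup>2 * norm (blinfun_apply (D a) b - blinfun_apply (D b) a) \<le> s\<^sup>2 * (4 * M\<^sup>2 * e)"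
      by (simp add: power2_eq_square mult_ac)
    then show ?thesis using s by simp
  qed
  have "norm (blinfun_apply (D a) b - blinfun_apply (D b) a) \<le> 0 + e" if e: "e > 0" for e
  proof -
    have "4 * M\<^sup>2 * (e / (4 * M\<^sup>2 + 1)) \<le> e"
      using e mult_left_mono[of "4 * M\<^sup>2" "4 * M\<^sup>2 + 1" e] by (simp add: pos_divide_le_eq add_nonneg_pos mult_ac)
    moreover have "e / (4 * M\<^sup>2 + 1) > 0" using e by (intro divide_pos_pos) (auto intro: add_nonneg_pos)
    ultimately show ?thesis using bound by fastforce
  qed
  then have "norm (blinfun_apply (D a) b - blinfun_apply (D b) a) \<le> 0" by (rule field_le_epsilon)
  then show ?thesis by simp
qed

subsection \<open>Quadrature identities from moments\<close>

text \<open>Nothing is known about \<open>f\<close> off \<open>K\<close>, but \<open>g\<close>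
  vanishes there, so \<open>f\<close> may be cut off by the indicator of \<open>K\<close>, which
  makes it measurable and bounded.\<close>

lemma integrable_continuous_on_mult:
  fixes f g :: "'a::euclidean_space \<Rightarrow> complex"
  assumes K: "compact K" and f: "continuous_on K f"
    and g: "integrable lborel g" "\<And>z. z \<notin> K \<Longrightarrow> g z = 0"
  shows "integrable lborel (\<lambda>z. f z * g z)"
proof -
  obtain B where B: "\<And>z. z \<in> K \<Longrightarrow> norm (f z) \<le> B"
    using compact_imp_bounded[OF compact_continuous_image[OF f K]] by (auto simp: bounded_iff)
  have eq: "(\<lambda>z. f z * g z) = (\<lambda>z. (indicator K z *\<^sub>R f z) * g z)"
    using g(2) by (auto simp: indicator_def)
  have [measurable]: "(\<lambda>z. indicator K z *\<^sub>R f z) \<in> borel_measurable lborel"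
    using borel_integrable_compact[OF K f] by (rule borel_measurable_integrable)
  note [measurable] = borel_measurable_integrable[OF g(1)]
  show ?thesis
    unfolding eq
  proof (rule Bochner_Integration.integrable_bound)
    show "integrable lborel (\<lambda>z. B *\<^sub>R norm (g z))" using g by simp
    show "(\<lambda>z. indicator K z *\<^sub>R f z * g z) \<in> borel_measurable lborel"
      by (rule borel_measurable_times) measurable
    show "AE z in lborel. norm (indicator K z *\<^sub>R f z * g z) \<le> norm (B *\<^sub>R norm (g z))"
      using B g(2) by (auto simp: indicator_def norm_mult intro!: AE_I2 mult_right_mono order_trans[OF _ abs_ge_self])
  qed
qed

text \<open>The compact set \<open>l * K\<close> has an \<open>e\<close>-neighbourhood inside
  \<open>V\<close>, and changing \<open>l\<close> by less than \<open>e / B\<close> moves its points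
  by less than \<open>e\<close>. This set of dilations is the domain of the parameter
  \<open>l\<close>.\<close>

lemma open_dilations_into:
  fixes K V :: "complex set"
  assumes "compact K" "open V"
  shows "open {l. \<forall>z\<in>K. l * z \<in> V}"
  unfolding open_contains_ball
proof
  fix l assume l: "l \<in> {l. \<forall>z\<in>K. l * z \<in> V}"
  have "compact ((*) l ` K)" using assms by (intro compact_continuous_image continuous_intros)
  then obtain e where e: "e > 0" "(\<Union>x\<in>(*) l ` K. ball x e) \<subseteq> V"
    using compact_subset_open_imp_ball_epsilon_subset[of "(*) l ` K" V] assms l by blast
  obtain B where B: "B > 0" "\<And>z. z \<in> K \<Longrightarrow> norm z \<le> B"
    using compact_imp_bounded[OF assms(1)] by (auto simp: bounded_pos)
  have "ball l (e / B) \<subseteq> {l. \<forall>z\<in>K. l * z \<in> V}"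
  proof (intro subsetI CollectI ballI)
    fix m z assume m: "m \<in> ball l (e / B)" and z: "z \<in> K"
    have "dist (l * z) (m * z) = dist l m * norm z"
      by (simp add: dist_norm norm_mult flip: left_diff_distrib)
    also have "\<dots> \<le> dist l m * B" using B z by (intro mult_left_mono) auto
    also have "\<dots> < e" using m B by (simp add: field_simps)
    finally show "m * z \<in> V" using e(2) z by (auto simp: subset_eq)
  qed
  then show "\<exists>e>0. ball l e \<subseteq> {l. \<forall>z\<in>K. l * z \<in> V}"
    using e(1) B(1) by (intro exI[of _ "e / B"]) simp
qed

text \<open>Differentiation under the integral by dominated convergence along sequences. Compactness
  of \<open>cball l e \<times> K\<close> bounds \<open>z * deriv F (m * z)\<close> by a constant
  \<open>B\<close>, and the mean value inequality on the convex disc turns this into a bound for the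
  difference quotients.\<close>

lemma has_field_derivative_integral_dilation:
  fixes g :: "complex \<Rightarrow> complex"
  assumes K: "compact K" and g: "integrable lborel g" "\<And>z. z \<notin> K \<Longrightarrow> g z = 0"
    and V: "open V" "F holomorphic_on V" and l: "\<forall>z\<in>K. l * z \<in> V"
  shows "((\<lambda>l. LINT z|lborel. F (l * z) * g z) has_field_derivative
           (LINT z|lborel. z * deriv F (l * z) * g z)) (at l)"
proof -
  let ?L = "{l. \<forall>z\<in>K. l * z \<in> V}"
  have "open ?L" using K V by (intro open_dilations_into)
  then obtain e where e: "e > 0" "cball l e \<subseteq> ?L" using l open_contains_cball by blast
  have cF: "continuous_on V F" and cF': "continuous_on V (deriv F)"
    using V by (auto intro: holomorphic_on_imp_continuous_on holomorphic_deriv)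
  have "continuous_on (cball l e \<times> K) (\<lambda>(m, z). z * deriv F (m * z))"
    using e by (auto intro!: continuous_intros continuous_on_compose2[OF cF'] simp: split_beta)
  then have "compact ((\<lambda>(m, z). z * deriv F (m * z)) ` (cball l e \<times> K))"
    using K by (intro compact_continuous_image compact_Times) auto
  from compact_imp_bounded[OF this]
  have "\<exists>B. \<forall>m\<in>cball l e. \<forall>z\<in>K. norm (z * deriv F (m * z)) \<le> B"
    by (simp add: bounded_iff)
  then obtain B where B: "\<And>m z. m \<in> cball l e \<Longrightarrow> z \<in> K \<Longrightarrow> norm (z * deriv F (m * z)) \<le> B"
    by blast
  have der: "((\<lambda>m. F (m * z)) has_field_derivative z * deriv F (m * z)) (at m)"
    if "m \<in> cball l e" "z \<in> K" for m z
  proof -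
    have "(F has_field_derivative deriv F (m * z)) (at (m * z))"
      using that e V by (intro holomorphic_derivI) auto
    from DERIV_chain2[where f = F and g = "\<lambda>m. m * z" and x = m, OF this, of z UNIV]
      DERIV_cmult_right[OF DERIV_ident, of z m UNIV] show ?thesis
      by (simp add: mult.commute)
  qed
  have int: "integrable lborel (\<lambda>z. F (m * z) * g z)" if "m \<in> cball l e" for m
    using that e by (intro integrable_continuous_on_mult[OF K _ g] continuous_on_compose2[OF cF] continuous_intros) auto
  have int': "integrable lborel (\<lambda>z. z * deriv F (l * z) * g z)"
    using l by (intro integrable_continuous_on_mult[OF K _ g] continuous_intros continuous_on_compose2[OF cF']) auto
  have lip: "norm (F (m * z) - F (l * z)) \<le> B * norm (m - l)" if "m \<in> cball l e" "z \<in> K" for m z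
  proof (rule field_differentiable_bound[of "cball l e" _ "\<lambda>m. z * deriv F (m * z)"])
    show "((\<lambda>m. F (m * z)) has_field_derivative z * deriv F (x * z)) (at x within cball l e)"
      if "x \<in> cball l e" for x
      using der[OF that \<open>z \<in> K\<close>] by (rule has_field_derivative_at_within)
  qed (use that B e(1) in auto)
  have lim: "((\<lambda>m. ((LINT z|lborel. F (m * z) * g z) - (LINT z|lborel. F (l * z) * g z)) / (m - l))
      \<longlongrightarrow> (LINT z|lborel. z * deriv F (l * z) * g z)) (at l within ball l e)"
    unfolding tendsto_at_iff_sequentially comp_def
  proof safe
    fix X assume X: "\<forall>i. X i \<in> ball l e - {l}" "X \<longlonglongrightarrow> l"
    then have Xc: "X i \<in> cball l e" "X i \<noteq> l" for i
      by (auto simp: less_imp_le)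
    have eq: "((LINT z|lborel. F (X i * z) * g z) - (LINT z|lborel. F (l * z) * g z)) / (X i - l)
       = (LINT z|lborel. (F (X i * z) - F (l * z)) / (X i - l) * g z)" for i
    proof -
      have "(LINT z|lborel. F (X i * z) * g z) - (LINT z|lborel. F (l * z) * g z)
         = (LINT z|lborel. F (X i * z) * g z - F (l * z) * g z)"
        using int[OF Xc(1)] int[of l] e(1) by (subst Bochner_Integration.integral_diff) auto
      then have "((LINT z|lborel. F (X i * z) * g z) - (LINT z|lborel. F (l * z) * g z)) / (X i - l)
         = (LINT z|lborel. (F (X i * z) * g z - F (l * z) * g z) / (X i - l))" by simp
      then show ?thesis by (simp add: field_simps)
    qed
    show "(\<lambda>i. ((LINT z|lborel. F (X i * z) * g z) - (LINT z|lborel. F (l * z) * g z)) / (X i - l))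
      \<longlonglongrightarrow> (LINT z|lborel. z * deriv F (l * z) * g z)"
      unfolding eq
    proof (rule integral_dominated_convergence[where w = "\<lambda>z. B * norm (g z)"])
      show "(\<lambda>z. z * deriv F (l * z) * g z) \<in> borel_measurable lborel"
        using int' by (rule borel_measurable_integrable)
      show "(\<lambda>z. (F (X i * z) - F (l * z)) / (X i - l) * g z) \<in> borel_measurable lborel" for i
      proof -
        have "integrable lborel (\<lambda>z. (F (X i * z) * g z - F (l * z) * g z) / (X i - l))"
          using int[OF Xc(1)] int[of l] e(1) by simp
        then show ?thesis by (simp add: field_simps borel_measurable_integrable)
      qed
      show "integrable lborel (\<lambda>z. B * norm (g z))" using g by simp
      show "AE z in lborel. (\<lambda>i. (F (X i * z) - F (l * z)) / (X i - l) * g z) \<longlonglongrightarrow> z * deriv F (l * z) * g z"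
      proof (rule AE_I2)
        fix z
        show "(\<lambda>i. (F (X i * z) - F (l * z)) / (X i - l) * g z) \<longlonglongrightarrow> z * deriv F (l * z) * g z"
        proof (cases "z \<in> K")
          case True
          have "((\<lambda>m. (F (m * z) - F (l * z)) / (m - l)) \<longlongrightarrow> z * deriv F (l * z)) (at l)"
            using der[OF _ True, of l] e(1) by (simp add: has_field_derivative_iff)
          then have "(\<lambda>i. (F (X i * z) - F (l * z)) / (X i - l)) \<longlonglongrightarrow> z * deriv F (l * z)"
            using X by (auto simp: tendsto_at_iff_sequentially comp_def)
          then show ?thesis by (intro tendsto_intros)
        qed (simp add: g)
      qed
      show "AE z in lborel. norm ((F (X i * z) - F (l * z)) / (X i - l) * g z) \<le> B * norm (g z)" for i
      proof (rule AE_I2)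
        fix z
        show "norm ((F (X i * z) - F (l * z)) / (X i - l) * g z) \<le> B * norm (g z)"
        proof (cases "z \<in> K")
          case True
          then have "norm ((F (X i * z) - F (l * z)) / (X i - l)) \<le> B"
            using lip[OF Xc(1) True, of i] Xc(2)[of i] by (simp add: norm_divide field_simps)
          then show ?thesis by (simp only: norm_mult) (intro mult_right_mono, auto)
        qed (simp add: g)
      qed
    qed
  qed
  then show ?thesis
    using e(1) by (simp add: has_field_derivative_iff at_within_open[of l "ball l e"])
qed

text \<open>Dilation takes the place of polynomial approximation of \<open>F\<close> on
  \<open>K\<close>. The admissible dilations form an open set that is starlike about 0, hence
  connected, and contains 1, so the identity theorem carries the information from
  \<open>l = 0\<close> to \<open>l = 1\<close>.\<close>

lemma quadrature_from_moments:
  fixes g :: "complex \<Rightarrow> complex" and w :: "complex \<Rightarrow> complex"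
  assumes K: "compact K" and g: "integrable lborel g" "\<And>z. z \<notin> K \<Longrightarrow> g z = 0"
    and A: "finite A" "A \<subseteq> K"
    and V: "open V" "K \<subseteq> V" "\<And>z. z \<in> V \<Longrightarrow> closed_segment 0 z \<subseteq> V"
    and F: "F holomorphic_on V"
    and moments: "\<And>n. (LINT z|lborel. z ^ n * g z) = (\<Sum>a\<in>A. w a * a ^ n)"
  shows "(LINT z|lborel. F z * g z) = (\<Sum>a\<in>A. w a * F a)"
\<comment> \<open>With \<open>K\<close> empty \<open>V\<close> may be empty too; otherwise a point
  of \<open>K\<close> and its segment give \<open>0 \<in> V\<close>.\<close>
proof (cases "K = {}")
  case True
  then show ?thesis using A g by auto
next
  case False
  define L where "L = {l. \<forall>z\<in>K. l * z \<in> V}"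
  have "open L" unfolding L_def using K V by (intro open_dilations_into)
  have "1 \<in> L" using V by (auto simp: L_def)
  have "0 \<in> V" using False V(2) V(3) ends_in_segment(1) by blast
  then have "0 \<in> L" by (auto simp: L_def)
  have "starlike L"
    unfolding starlike_def
  proof (intro bexI[OF _ \<open>0 \<in> L\<close>] ballI subsetI)
    fix l x assume l: "l \<in> L" and x: "x \<in> closed_segment 0 l"
    then obtain u where u: "0 \<le> u" "u \<le> 1" "x = u *\<^sub>R l" by (auto simp: closed_segment_def)
    show "x \<in> L"
      unfolding L_def
    proof safe
      fix z assume "z \<in> K"
      then have "closed_segment 0 (l * z) \<subseteq> V" using V(3) l by (simp add: L_def)
      moreover have "x * z \<in> closed_segment 0 (l * z)"
        using u by (auto simp: closed_segment_def intro!: exI[of _ u])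
      ultimately show "x * z \<in> V" by blast
    qed
  qed
  then have conn: "connected L" by (rule starlike_imp_connected)
  \<comment> \<open>\<open>\<Psi> k\<close> is the expected \<open>k\<close>-th derivative of the
    defect. Each differentiation releases a factor \<open>z\<close>, so at \<open>l = 0\<close> it
    equals \<open>(deriv ^^ k) F 0\<close> times the defect of the \<open>k\<close>-th
    moment.\<close>
  define \<Psi> where "\<Psi> = (\<lambda>k l. (LINT z|lborel. (deriv ^^ k) F (l * z) * (z ^ k * g z))
                            - (\<Sum>a\<in>A. w a * a ^ k * (deriv ^^ k) F (l * a)))"
  have der: "(\<Psi> k has_field_derivative \<Psi> (Suc k) l) (at l)" if l: "l \<in> L" for k l
  proof -
    have hol: "(deriv ^^ k) F holomorphic_on V" using F V by (intro holomorphic_higher_deriv)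
    have int: "integrable lborel (\<lambda>z. z ^ k * g z)"
      by (intro integrable_continuous_on_mult[OF K _ g] continuous_intros)
    have "((\<lambda>l. LINT z|lborel. (deriv ^^ k) F (l * z) * (z ^ k * g z)) has_field_derivative
           (LINT z|lborel. z * deriv ((deriv ^^ k) F) (l * z) * (z ^ k * g z))) (at l)"
      by (rule has_field_derivative_integral_dilation[OF K int _ V(1) hol])
         (use g l in \<open>auto simp: L_def\<close>)
    moreover have "(\<lambda>z. z * deriv ((deriv ^^ k) F) (l * z) * (z ^ k * g z)) = (\<lambda>z. (deriv ^^ Suc k) F (l * z) * (z ^ Suc k * g z))"
      by (simp add: fun_eq_iff)
    ultimately have 1: "((\<lambda>l. LINT z|lborel. (deriv ^^ k) F (l * z) * (z ^ k * g z)) has_field_derivative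
           (LINT z|lborel. (deriv ^^ Suc k) F (l * z) * (z ^ Suc k * g z))) (at l)" by simp
    have 2: "((\<lambda>l. (deriv ^^ k) F (l * a)) has_field_derivative a * (deriv ^^ Suc k) F (l * a)) (at l)"
      if "a \<in> A" for a
    proof -
      have "((deriv ^^ k) F has_field_derivative deriv ((deriv ^^ k) F) (l * a)) (at (l * a))"
        using that l A V by (intro holomorphic_derivI[OF hol]) (auto simp: L_def)
      from DERIV_chain2[where f = "(deriv ^^ k) F" and g = "\<lambda>m. m * a" and x = l, OF this, of a UNIV]
        DERIV_cmult_right[OF DERIV_ident, of a l UNIV] show ?thesis
        by (simp add: mult.commute)
    qed
    have 3: "((\<lambda>l. \<Sum>a\<in>A. w a * a ^ k * (deriv ^^ k) F (l * a)) has_field_derivative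
          (\<Sum>a\<in>A. w a * a ^ k * (a * (deriv ^^ Suc k) F (l * a)))) (at l)"
      by (intro DERIV_sum DERIV_cmult 2)
    have "(\<Sum>a\<in>A. w a * a ^ k * (a * (deriv ^^ Suc k) F (l * a))) = (\<Sum>a\<in>A. w a * a ^ Suc k * (deriv ^^ Suc k) F (l * a))"
      by (simp add: mult_ac)
    then show ?thesis
      using DERIV_diff[OF 1 3] unfolding \<Psi>_def by simp
  qed
  have higher: "(deriv ^^ k) (\<Psi> 0) l = \<Psi> k l" if "l \<in> L" for k l
    using that
  proof (induction k arbitrary: l)
    case (Suc k)
    have "eventually (\<lambda>x. (deriv ^^ k) (\<Psi> 0) x = \<Psi> k x) (nhds l)"
      using Suc \<open>open L\<close> eventually_nhds by blast
    then have "deriv ((deriv ^^ k) (\<Psi> 0)) l = deriv (\<Psi> k) l" by (rule deriv_cong_ev) simp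
    also have "\<dots> = \<Psi> (Suc k) l" using der[OF Suc.prems] by (rule DERIV_imp_deriv)
    finally show ?case by simp
  qed simp
  have zero: "\<Psi> k 0 = 0" for k
  proof -
    have "(LINT z|lborel. (deriv ^^ k) F 0 * (z ^ k * g z)) = (\<Sum>a\<in>A. (deriv ^^ k) F 0 * (w a * a ^ k))"
      using moments[of k] by (simp add: sum_distrib_left)
    then show ?thesis by (simp add: \<Psi>_def mult_ac)
  qed
  have "\<Psi> 0 holomorphic_on L"
    using der \<open>open L\<close> by (auto simp: holomorphic_on_open)
  then have "\<Psi> 0 1 = 0"
    by (rule holomorphic_fun_eq_0_on_connected[OF _ \<open>open L\<close> conn _ \<open>0 \<in> L\<close> \<open>1 \<in> L\<close>])
       (use higher \<open>0 \<in> L\<close> zero in simp)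
  then show ?thesis by (simp add: \<Psi>_def)
qed

subsection \<open>Integration along the lines through the origin\<close>

lemma lborel_complex_eq_distr:
  "(lborel :: complex measure) = distr (lborel \<Otimes>\<^sub>M lborel) borel (\<lambda>(x, y). Complex x y)"
proof (rule lborel_eqI)
  have [measurable]: "(\<lambda>(x, y). Complex x y) \<in> borel_measurable (borel \<Otimes>\<^sub>M borel)"
    unfolding Complex_eq by measurable
  fix l u :: complex
  assume "\<And>b. b \<in> Basis \<Longrightarrow> l \<bullet> b \<le> u \<bullet> b"
  from this[of 1] this[of \<i>] have le: "Re l \<le> Re u" "Im l \<le> Im u"
    by (simp_all add: Basis_complex_def)
  have eq: "(\<lambda>(x, y). Complex x y) -` box l u = box (Re l) (Re u) \<times> box (Im l) (Im u)"
    by (auto simp: in_box_complex_iff)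
  have "emeasure (distr (lborel \<Otimes>\<^sub>M lborel) borel (\<lambda>(x, y). Complex x y)) (box l u)
      = emeasure (lborel \<Otimes>\<^sub>M lborel) (box (Re l) (Re u) \<times> box (Im l) (Im u))"
    by (subst emeasure_distr) (simp_all add: eq space_pair_measure)
  also have "\<dots> = ennreal (Re u - Re l) * ennreal (Im u - Im l)"
    using le by (subst lborel.emeasure_pair_measure_Times) auto
  finally show "emeasure (distr (lborel \<Otimes>\<^sub>M lborel) borel (\<lambda>(x, y). Complex x y)) (box l u) = (\<Prod>b\<in>Basis. (u - l) \<bullet> b)"
    using le by (simp add: Basis_complex_def ennreal_mult)
qed simp

text \<open>For fixed \<open>x \<noteq> 0\<close> substitute \<open>y = x * v\<close>, with Jacobian
  \<open>\<bar>x\<bar>\<close>, and exchange the integrals. Using the slope instead of the angle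
  keeps the substitution affine in one real variable.\<close>

lemma integral_over_lines_through_origin:
  fixes f :: "complex \<Rightarrow> complex"
  assumes f: "integrable lborel f"
  shows "(LINT z|lborel. f z) = (LBINT v. LBINT x. \<bar>x\<bar> *\<^sub>R f (x *\<^sub>R Complex 1 v))"
proof -
  have [measurable]: "(\<lambda>(x, y). Complex x y) \<in> borel_measurable (borel \<Otimes>\<^sub>M borel)"
    unfolding Complex_eq by measurable
  have [measurable]: "f \<in> borel_measurable borel" using borel_measurable_integrable[OF f] by simp
  define F where "F = (\<lambda>p. f (Complex (fst p) (snd p)))"
  define G where "G = (\<lambda>p. \<bar>fst p\<bar> *\<^sub>R f (Complex (fst p) (fst p * snd p)))"
  have F: "integrable (lborel \<Otimes>\<^sub>M lborel) F"
    using f unfolding F_def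
    by (subst (asm) lborel_complex_eq_distr) (simp add: integrable_distr_eq split_beta)
  have Feq: "(LINT z|lborel. f z) = integral\<^sup>L (lborel \<Otimes>\<^sub>M lborel) F"
    unfolding F_def by (subst lborel_complex_eq_distr) (simp add: integral_distr split_beta)
  have ae0: "AE x in lborel. (x::real) \<noteq> 0" by (rule AE_lborel_singleton)
  have slice: "(LBINT v. G (x, v)) = (LBINT y. F (x, y))" "(LBINT v. norm (G (x, v))) = (LBINT y. norm (F (x, y)))"
    "integrable lborel (\<lambda>y. F (x, y)) \<Longrightarrow> integrable lborel (\<lambda>v. G (x, v))" if "x \<noteq> 0" for x
  proof -
    show "(LBINT v. G (x, v)) = (LBINT y. F (x, y))"
      using lborel_integral_real_affine[OF that, of "\<lambda>y. F (x, y)" 0] by (simp add: F_def G_def)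
    show "(LBINT v. norm (G (x, v))) = (LBINT y. norm (F (x, y)))"
      using lborel_integral_real_affine[OF that, of "\<lambda>y. norm (F (x, y))" 0] by (simp add: F_def G_def)
    show "integrable lborel (\<lambda>v. G (x, v))" if "integrable lborel (\<lambda>y. F (x, y))"
      using lborel_integrable_real_affine[OF that \<open>x \<noteq> 0\<close>, of 0] by (simp add: F_def G_def)
  qed
  have mG[measurable]: "G \<in> borel_measurable (lborel \<Otimes>\<^sub>M lborel)"
    unfolding G_def Complex_eq by measurable
  have mF[measurable]: "F \<in> borel_measurable (lborel \<Otimes>\<^sub>M lborel)"
    using F by (rule borel_measurable_integrable)
  \<comment> \<open>The exchange needs joint integrability of \<open>G\<close>; it is inherited from
    \<open>F\<close> because the slices at \<open>x \<noteq> 0\<close> have equal norm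
    integrals.\<close>
  have G: "integrable (lborel \<Otimes>\<^sub>M lborel) G"
  proof (rule lborel_pair.Fubini_integrable[OF mG])
    have "integrable lborel (\<lambda>x. LBINT y. norm (F (x, y)))"
      using lborel_pair.integrable_fst'[OF integrable_norm[OF F]] .
    then show "integrable lborel (\<lambda>x. LBINT y. norm (G (x, y)))"
      by (rule Bochner_Integration.integrable_cong_AE_imp) (use ae0 in \<open>auto simp: slice(2) elim: AE_mp\<close>)
    show "AE x in lborel. integrable lborel (\<lambda>v. G (x, v))"
      using lborel_pair.AE_integrable_fst'[OF F] ae0 by eventually_elim (rule slice(3))
  qed
  have "integral\<^sup>L (lborel \<Otimes>\<^sub>M lborel) F = (LBINT x. LBINT y. F (x, y))"
    by (rule lborel_pair.integral_fst'[OF F, symmetric])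
  also have "\<dots> = (LBINT x. LBINT v. G (x, v))"
    by (rule integral_cong_AE) (use ae0 in \<open>auto simp: slice(1) elim: AE_mp\<close>)
  also have "\<dots> = (LBINT v. LBINT x. G (x, v))"
    using lborel_pair.Fubini_integral[of "\<lambda>x v. G (x, v)"] G by simp
  finally have "integral\<^sup>L (lborel \<Otimes>\<^sub>M lborel) F = (LBINT v. LBINT x. G (x, v))" .
  moreover have Geq: "G (x, v) = \<bar>x\<bar> *\<^sub>R f (x *\<^sub>R Complex 1 v)" for x v
    by (simp add: G_def complex_eq_iff scaleR_complex.ctr)
  ultimately show "(LINT z|lborel. f z) = (LBINT v. LBINT x. \<bar>x\<bar> *\<^sub>R f (x *\<^sub>R Complex 1 v))"
    using Feq by simp
qed

text \<open>The integral over the positive half comes from a primitive; reflection gives the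
  negative half with the sign \<open>(-1) ^ n\<close>, so odd powers cancel.\<close>

lemma has_bochner_integral_abs_mult_power:
  fixes X :: real
  assumes "0 \<le> X"
  shows "has_bochner_integral lborel (\<lambda>x. \<bar>x\<bar> * x ^ n * indicator {x. x\<^sup>2 < X} x)
           (if even n then 2 * sqrt X ^ (n + 2) / (n + 2) else 0)"
proof -
  have pos: "has_bochner_integral lborel (\<lambda>x. x ^ (n + 1) * indicator {0..sqrt X} x) (sqrt X ^ (n + 2) / (n + 2))"
  proof -
    have "has_bochner_integral lborel (\<lambda>x. x ^ (n + 1) * indicator {0..sqrt X} x)
        (sqrt X ^ (n + 2) / (n + 2) - 0 ^ (n + 2) / (n + 2))"
    proof (rule has_bochner_integral_FTC_Icc_real)
      show "((\<lambda>x. x ^ (n + 2) / (n + 2)) has_real_derivative x ^ (n + 1)) (at x)" for x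
      proof -
        have "((\<lambda>x. x ^ (n + 2) / (n + 2)) has_real_derivative real (n + 2) * x ^ (n + 1) / (n + 2)) (at x)"
          using DERIV_cdivide[OF DERIV_pow[where n = "n + 2" and x = x and s = UNIV], of "real (n + 2)"] by simp
        moreover have "real (n + 2) * x ^ (n + 1) / (n + 2) = x ^ (n + 1)" by simp
        ultimately show ?thesis by metis
      qed
    qed (use assms in auto)
    then show ?thesis by simp
  qed
  let ?g = "\<lambda>x. x ^ (n + 1) * indicator {0..sqrt X} x"
  have neg: "has_bochner_integral lborel (\<lambda>x. (-1) ^ n * ?g (0 + (-1) * x)) ((-1) ^ n * (sqrt X ^ (n + 2) / (n + 2)))"
    using pos by (intro has_bochner_integral_mult_right)
      (subst (asm) lborel_has_bochner_integral_real_affine_iff[where c = "-1" and t = 0], auto)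
  have "has_bochner_integral lborel (\<lambda>x. ?g x + (-1) ^ n * ?g (0 + (-1) * x))
      (sqrt X ^ (n + 2) / (n + 2) + (-1) ^ n * (sqrt X ^ (n + 2) / (n + 2)))"
    using pos neg by (rule has_bochner_integral_add)
  moreover have "sqrt X ^ (n + 2) / (n + 2) + (-1) ^ n * (sqrt X ^ (n + 2) / (n + 2))
      = (if even n then 2 * sqrt X ^ (n + 2) / (n + 2) else 0)"
  proof -
    have "(y::real) + (-1) ^ n * y = (if even n then 2 * y else 0)" for y by simp
    then show ?thesis by simp
  qed
  \<comment> \<open>The two closed half-intervals share 0 and include the endpoints, which the
    strict inequality excludes; these three points are null.\<close>
  moreover have "AE x in lborel. ?g x + (-1) ^ n * ?g (0 + (-1) * x) = \<bar>x\<bar> * x ^ n * indicator {x. x\<^sup>2 < X} x"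
    using AE_lborel_singleton[of 0] AE_lborel_singleton[of "sqrt X"] AE_lborel_singleton[of "- sqrt X"]
  proof eventually_elim
    fix x :: real assume x: "x \<noteq> 0" "x \<noteq> sqrt X" "x \<noteq> - sqrt X"
    have iff: "x\<^sup>2 < X \<longleftrightarrow> \<bar>x\<bar> < sqrt X"
      using real_sqrt_less_iff[of "x\<^sup>2" X] by simp
    show "?g x + (-1) ^ n * ?g (0 + (-1) * x) = \<bar>x\<bar> * x ^ n * indicator {x. x\<^sup>2 < X} x"
    proof (cases "x > 0")
      case True
      then show ?thesis using x iff by (auto simp: indicator_def)
    next
      case False
      have "(-1) ^ n * (-x) ^ n = x ^ n" by (simp flip: power_mult_distrib)
      then show ?thesis using x iff False by (auto simp: indicator_def)
    qed
  qed
  ultimately show ?thesis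
    by (subst has_bochner_integral_cong_AE[symmetric]) auto
qed

subsection \<open>Laurent polynomials in the Cayley transform\<close>

text \<open>On the line \<open>v = tan \<theta>\<close> the value is \<open>exp (2 * \<i> * \<theta>)\<close>.\<close>
definition cayley :: "real \<Rightarrow> complex" where
  "cayley v = Complex 1 v / Complex 1 (- v)"

lemma Complex_1_nonzero [simp]: "Complex 1 v \<noteq> 0"
  by (simp add: complex_eq_iff)

lemma cnj_Complex: "cnj (Complex a b) = Complex a (- b)"
  by (simp add: complex_eq_iff)

lemma cayley_nonzero: "cayley v \<noteq> 0"
  by (simp add: cayley_def)

lemma Complex_mult_cnj_1: "Complex 1 v * Complex 1 (- v) = of_real (1 + v\<^sup>2)"
  by (simp add: complex_eq_iff power2_eq_square)

lemma cayley_eq: "cayley v = (Complex 1 v)\<^sup>2 / of_real (1 + v\<^sup>2)"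
  unfolding cayley_def Complex_mult_cnj_1[symmetric] power2_eq_square[of "Complex 1 v"]
  by (rule mult_divide_mult_cancel_left[symmetric]) simp

lemma norm_cayley: "norm (cayley v) = 1"
  using add_pos_nonneg[OF zero_less_one zero_le_power2[of v]]
  by (simp add: cayley_def norm_divide complex_norm)

lemma inverse_cayley: "inverse (cayley v) = cnj (cayley v)"
  by (simp add: cayley_def cnj_Complex)

lemma continuous_cayley: "continuous_on S cayley"
  unfolding cayley_def Complex_eq
  by (intro continuous_intros) (auto simp: complex_eq_iff)

text \<open>For v = tan \<theta> this is 2 cos 2\<theta>; it expresses the sum of the roots on a
  line through \<open>cayley v\<close>.\<close>

lemma cayley_plus_inverse: "cayley v + inverse (cayley v) = of_real (2 * ((1 - v\<^sup>2) / (1 + v\<^sup>2)))"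
proof -
  have sq: "(Complex 1 v)\<^sup>2 = Complex (1 - v\<^sup>2) (2 * v)"
    by (simp add: complex_eq_iff power2_eq_square)
  have "Re (cayley v) = (1 - v\<^sup>2) / (1 + v\<^sup>2)"
    by (simp only: cayley_eq sq Re_divide_of_real complex.sel)
  then show ?thesis unfolding inverse_cayley complex_add_cnj by (simp only:)
qed

text \<open>This is the derivative of exp(2i\<theta>) with d\<theta> = dv / (1 + v^2), so every
  nonzero power of \<open>cayley\<close> has an explicit primitive for the weight 1 / (1 +
  v^2).\<close>

lemma has_vector_derivative_cayley:
  "(cayley has_vector_derivative (2 * \<i> * cayley v / of_real (1 + v\<^sup>2))) (at v)"
proof -
  have nz: "1 - \<i> * of_real v \<noteq> 0" "1 + \<i> * of_real v \<noteq> 0" by (auto simp: complex_eq_iff)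
  have "((\<lambda>z. (1 + \<i> * z) / (1 - \<i> * z)) has_field_derivative
      (\<i> * (1 - \<i> * of_real v) + (1 + \<i> * of_real v) * \<i>) / ((1 - \<i> * of_real v) * (1 - \<i> * of_real v))) (at (of_real v))"
    using nz by (auto intro!: derivative_eq_intros)
  from has_vector_derivative_real_field[OF this]
  have "((\<lambda>x. (1 + \<i> * of_real x) / (1 - \<i> * of_real x)) has_vector_derivative
      (\<i> * (1 - \<i> * of_real v) + (1 + \<i> * of_real v) * \<i>) / ((1 - \<i> * of_real v) * (1 - \<i> * of_real v))) (at v)" .
  moreover have "(\<lambda>x. (1 + \<i> * of_real x) / (1 - \<i> * of_real x)) = cayley"
    by (simp add: cayley_def Complex_eq fun_eq_iff)
  moreover have "(\<i> * (1 - \<i> * of_real v) + (1 + \<i> * of_real v) * \<i>) / ((1 - \<i> * of_real v) * (1 - \<i> * of_real v))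
     = 2 * \<i> * cayley v / of_real (1 + v\<^sup>2)"
  proof -
    have "of_real (1 + v\<^sup>2) = (1 + \<i> * of_real v) * (1 - \<i> * of_real v)"
      by (simp add: complex_eq_iff power2_eq_square)
    moreover have "cayley v = (1 + \<i> * of_real v) / (1 - \<i> * of_real v)"
      by (simp add: cayley_def Complex_eq)
    moreover have "\<i> * (1 - \<i> * of_real v) + (1 + \<i> * of_real v) * \<i> = 2 * \<i>"
      by (simp add: algebra_simps)
    ultimately show ?thesis using nz by simp
  qed
  ultimately show ?thesis by simp
qed

text \<open>From \<open>cayley v = -1 + 2 / (1 - \<i> * v)\<close>. The limit is the same at both
  ends of the real line, so the boundary terms of the primitives cancel.\<close>

lemma tendsto_cayley:
  assumes "filterlim (of_real :: real \<Rightarrow> complex) at_infinity F"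
  shows "(cayley \<longlongrightarrow> -1) F"
proof -
  have "filterlim (\<lambda>v. - \<i> * of_real v) at_infinity F"
    by (rule tendsto_mult_filterlim_at_infinity[OF tendsto_const _ assms]) simp
  then have "filterlim (\<lambda>v. 1 + - \<i> * of_real v) at_infinity F"
    by (rule tendsto_add_filterlim_at_infinity[OF tendsto_const])
  then have "((\<lambda>v. -1 + 2 / (1 + - \<i> * of_real v)) \<longlongrightarrow> -1 + 0) F"
    by (intro tendsto_intros tendsto_divide_0[OF tendsto_const])
  moreover have "-1 + 2 / (1 + - \<i> * of_real v) = cayley v" for v
  proof -
    have "1 + - \<i> * of_real v \<noteq> 0" by (simp add: complex_eq_iff)
    then show ?thesis by (simp add: cayley_def Complex_eq divide_simps)
  qed
  ultimately show ?thesis by simp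
qed

lemma integrable_inverse_1_plus_square_UNIV: "integrable lborel (\<lambda>v::real. 1 / (1 + v\<^sup>2))"
  using integrable_inverse_1_plus_square by (simp add: set_integrable_def inverse_eq_divide)

lemma integrable_cayley_power: "integrable lborel (\<lambda>v. cayley v ^ k / of_real (1 + v\<^sup>2))"
proof (rule Bochner_Integration.integrable_bound[OF integrable_inverse_1_plus_square_UNIV])
  have [measurable]: "cayley \<in> borel_measurable borel"
    using continuous_cayley by (rule borel_measurable_continuous_onI)
  show "(\<lambda>v. cayley v ^ k / of_real (1 + v\<^sup>2)) \<in> borel_measurable lborel" by measurable
qed (simp add: norm_divide norm_power norm_cayley del: of_real_add)

lemma has_bochner_integral_cayley_power:
  assumes "k > 0"
  shows "has_bochner_integral lborel (\<lambda>v. cayley v ^ k / of_real (1 + v\<^sup>2)) 0"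
proof -
  have nz: "of_real (1 + v\<^sup>2) \<noteq> (0::complex)" for v :: real
    unfolding of_real_eq_0_iff by (smt (verit) zero_le_power2)
  have der: "((\<lambda>v. cayley v ^ k / (2 * \<i> * of_nat k)) has_vector_derivative cayley v ^ k / of_real (1 + v\<^sup>2)) (at v)" for v
  proof -
    have "((\<lambda>z. z ^ k / (2 * \<i> * of_nat k)) has_field_derivative of_nat k * cayley v ^ (k - 1) / (2 * \<i> * of_nat k)) (at (cayley v))"
      by (auto intro!: derivative_eq_intros)
    from field_vector_diff_chain_at[OF has_vector_derivative_cayley this]
    have "((\<lambda>v. cayley v ^ k / (2 * \<i> * of_nat k)) has_vector_derivative
       (2 * \<i> * cayley v / of_real (1 + v\<^sup>2)) * (of_nat k * cayley v ^ (k - 1) / (2 * \<i> * of_nat k))) (at v)"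
      by (simp add: o_def)
    moreover have "(2 * \<i> * cayley v / of_real (1 + v\<^sup>2)) * (of_nat k * cayley v ^ (k - 1) / (2 * \<i> * of_nat k))
        = cayley v ^ k / of_real (1 + v\<^sup>2)"
    proof -
      have "cayley v * cayley v ^ (k - 1) = cayley v ^ k"
        using assms by (simp add: power_eq_if)
      then have "(2 * \<i> * cayley v) * (of_nat k * cayley v ^ (k - 1)) = cayley v ^ k * (2 * \<i> * of_nat k)"
        by (metis mult.assoc mult.commute)
      then show ?thesis
        using assms unfolding times_divide_times_eq by simp
    qed
    ultimately show ?thesis by (simp only:)
  qed
  have lims: "((\<lambda>v. cayley v ^ k / (2 * \<i> * of_nat k)) \<longlongrightarrow> (-1) ^ k / (2 * \<i> * of_nat k)) F"
    if "filterlim (of_real :: real \<Rightarrow> complex) at_infinity F" for F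
    using assms by (intro tendsto_intros tendsto_cayley that) auto
  have bot: "filterlim (of_real :: real \<Rightarrow> complex) at_infinity at_bot"
    unfolding filterlim_at_infinity_conv_norm_at_top
    by (rule filterlim_at_top_mono[OF filterlim_uminus_at_top_at_bot]) (simp add: abs_ge_minus_self)
  have "(LBINT v=-\<infinity>..\<infinity>. cayley v ^ k / of_real (1 + v\<^sup>2)) = (-1) ^ k / (2 * \<i> * of_nat k) - (-1) ^ k / (2 * \<i> * of_nat k)"
  proof (rule interval_integral_FTC_integrable[where F = "\<lambda>v. cayley v ^ k / (2 * \<i> * of_nat k)"])
    show "isCont (\<lambda>v. cayley v ^ k / of_real (1 + v\<^sup>2)) x" for x
    proof -
      have "isCont cayley x"
        using continuous_cayley[of UNIV] by (simp add: continuous_on_eq_continuous_at)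
      moreover have "isCont (\<lambda>v::real. of_real (1 + v\<^sup>2) :: complex) x" by (intro continuous_intros)
      ultimately show ?thesis using nz by (intro isCont_divide isCont_power)
    qed
    show "set_integrable lborel (einterval (- \<infinity>) \<infinity>) (\<lambda>v. cayley v ^ k / of_real (1 + v\<^sup>2))"
      using integrable_cayley_power by (simp add: set_integrable_def)
    show "(((\<lambda>v. cayley v ^ k / (2 * \<i> * of_nat k)) \<circ> real_of_ereal) \<longlongrightarrow> (-1) ^ k / (2 * \<i> * of_nat k)) (at_right (- \<infinity>))"
      unfolding ereal_tendsto_simps by (rule lims[OF bot])
    show "(((\<lambda>v. cayley v ^ k / (2 * \<i> * of_nat k)) \<circ> real_of_ereal) \<longlongrightarrow> (-1) ^ k / (2 * \<i> * of_nat k)) (at_left \<infinity>)"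
      unfolding ereal_tendsto_simps by (rule lims[OF filterlim_of_real_at_infinity])
  qed (use der in auto)
  then show ?thesis
    using integrable_cayley_power[of k]
    by (simp add: has_bochner_integral_iff interval_lebesgue_integral_def set_lebesgue_integral_def)
qed

text \<open>\<open>cayley\<close> runs once around the unit circle, so only the constant term of the
  Laurent polynomial survives, with weight \<pi>. The single division by \<open>cayley v\<close>
  moves that term to the coefficient of index 1.\<close>

lemma has_bochner_integral_poly_cayley:
  "has_bochner_integral lborel (\<lambda>v. poly p (cayley v) / cayley v / of_real (1 + v\<^sup>2)) (of_real pi * coeff p 1)"
proof -
  have mono: "has_bochner_integral lborel (\<lambda>v. cayley v ^ i / cayley v / of_real (1 + v\<^sup>2)) (if i = 1 then of_real pi else 0)" for i
  proof -
    consider "i = 0" | "i = 1" | k where "i = Suc k" "k > 0"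
      by (metis One_nat_def neq0_conv not0_implies_Suc)
    then show ?thesis
    proof cases
      case 1
      \<comment> \<open>The power -1 is the conjugate of the first power, since
        \<open>cayley v\<close> has modulus 1.\<close>
      have "has_bochner_integral lborel (\<lambda>v. cnj (cayley v ^ 1 / of_real (1 + v\<^sup>2))) (cnj 0)"
        by (rule has_bochner_integral_bounded_linear[OF bounded_linear_cnj has_bochner_integral_cayley_power]) simp
      then show ?thesis using 1 by (simp add: inverse_cayley[symmetric] divide_inverse)
    next
      case 2
      have "has_bochner_integral lborel (\<lambda>v::real. 1 / (1 + v\<^sup>2)) pi"
        using integrable_inverse_1_plus_square_UNIV LBINT_inverse_1_plus_square
        by (simp add: has_bochner_integral_iff interval_lebesgue_integral_def set_lebesgue_integral_def inverse_eq_divide)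
      from has_bochner_integral_of_real[OF this, where 'a = complex]
      show ?thesis using 2 cayley_nonzero by simp
    next
      case 3
      then show ?thesis using has_bochner_integral_cayley_power[of k] cayley_nonzero by simp
    qed
  qed
  \<comment> \<open>Summing up to \<open>degree p + 1\<close> ensures that index 1 occurs even when
    \<open>p\<close> is constant.\<close>
  have "has_bochner_integral lborel (\<lambda>v. \<Sum>i\<le>degree p + 1. coeff p i * (cayley v ^ i / cayley v / of_real (1 + v\<^sup>2)))
      (\<Sum>i\<le>degree p + 1. coeff p i * (if i = 1 then of_real pi else 0))"
    by (intro has_bochner_integral_sum has_bochner_integral_mult_right mono)
  moreover have "(\<Sum>i\<le>degree p + 1. coeff p i * (if i = 1 then of_real pi else 0)) = of_real pi * coeff p 1"
    by (simp add: if_distrib[of "(*) _"] sum.delta cong: if_cong)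
  moreover have "(\<Sum>i\<le>degree p + 1. coeff p i * (cayley v ^ i / cayley v / of_real (1 + v\<^sup>2)))
      = poly p (cayley v) / cayley v / of_real (1 + v\<^sup>2)" for v
  proof -
    have "poly p (cayley v) = (\<Sum>i\<le>degree p + 1. coeff p i * cayley v ^ i)"
      by (simp add: poly_altdef coeff_eq_0)
    then show ?thesis by (simp only: sum_divide_distrib times_divide_eq_right)
  qed
  ultimately show ?thesis by simp
qed

text \<open>Newton's recursion for the power sums of the roots of \<open>X\<^sup>2 - (4 + E + 1/E) * X + q\<close>, the \<open>k\<close>-th one
  multiplied by \<open>E ^ k\<close> to clear denominators.\<close>
fun power_sum_poly :: "complex \<Rightarrow> nat \<Rightarrow> complex poly" where
  "power_sum_poly q 0 = [:2:]"
| "power_sum_poly q (Suc 0) = [:1, 4, 1:]"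
| "power_sum_poly q (Suc (Suc k)) = [:1, 4, 1:] * power_sum_poly q (Suc k) - [:0, 0, q:] * power_sum_poly q k"

lemma poly_power_sum_poly:
  assumes "E * (s + s') = 1 + 4 * E + E\<^sup>2" "s * s' = q"
  shows "poly (power_sum_poly q k) E = E ^ k * (s ^ k + s' ^ k)"
proof (induction k rule: induct_nat_012)
  case (ge2 k)
  have "poly (power_sum_poly q (Suc (Suc k))) E
      = (1 + 4 * E + E\<^sup>2) * poly (power_sum_poly q (Suc k)) E - q * E\<^sup>2 * poly (power_sum_poly q k) E"
    by (simp add: algebra_simps power2_eq_square)
  also have "\<dots> = E * (s + s') * (E ^ Suc k * (s ^ Suc k + s' ^ Suc k)) - s * s' * E\<^sup>2 * (E ^ k * (s ^ k + s' ^ k))"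
    by (simp only: ge2 assms)
  also have "\<dots> = E ^ Suc (Suc k) * (s ^ Suc (Suc k) + s' ^ Suc (Suc k))"
    by (simp add: algebra_simps power2_eq_square)
  finally show ?case .
qed (use assms(1) in \<open>auto simp: power2_eq_square algebra_simps\<close>)

text \<open>The parameter \<open>q\<close> enters the recursion with a factor X^2, so the two lowest
  coefficients agree with those of (1 + 4 X)^k. Index 0 is left out because the zeroth power sum is
  2, not 1.\<close>

lemma coeff_power_sum_poly:
  "coeff (power_sum_poly q (Suc k)) 0 = 1 \<and> coeff (power_sum_poly q (Suc k)) 1 = 4 * of_nat (Suc k)"
proof (induction k rule: less_induct)
  case (less k)
  show ?case
  proof (cases k)
    case (Suc j)
    then show ?thesis using less[of j] by (simp add: coeff_pCons algebra_simps)
  qed simp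
qed

subsection \<open>The density\<close>

lemma Q_diag_eq: "Q_diag z = ((cmod z)\<^sup>2 - 1)\<^sup>2 - 4 * (Re z)\<^sup>2"
proof -
  have "(cmod (z - 1))\<^sup>2 - 2 = (cmod z)\<^sup>2 - 1 - 2 * Re z" "(cmod (z + 1))\<^sup>2 - 2 = (cmod z)\<^sup>2 - 1 + 2 * Re z"
    unfolding cmod_power2 by (simp_all add: power2_eq_square algebra_simps)
  then show ?thesis unfolding Q_diag_def by (simp only:) (simp add: power2_eq_square algebra_simps)
qed

text \<open>Outside the open unit disc, moving outward never enters \<open>\<Omega> t\<close>. This
  gives both the rays to infinity that identify the hole and the starlikeness of the
  support.\<close>

lemma Q_diag_expanding:
  assumes "0 \<le> t" "t \<le> Q_diag z" "1 \<le> cmod z" "1 \<le> r"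
  shows "t \<le> Q_diag (r *\<^sub>R z)"
proof -
  define s where "s = (cmod z)\<^sup>2"
  have s: "1 \<le> s" using assms by (simp add: s_def)
  \<comment> \<open>This expression is the difference
    \<open>(r\<^sup>2 * s - 1) - r * (s - 1)\<close>.\<close>
  have "0 \<le> r * s * (r - 1) + (r - 1)" using assms s by auto
  then have "r * (s - 1) \<le> r\<^sup>2 * s - 1" by (simp add: algebra_simps power2_eq_square)
  then have "(r * (s - 1))\<^sup>2 \<le> (r\<^sup>2 * s - 1)\<^sup>2" using assms s by (intro power_mono) auto
  moreover have "r\<^sup>2 * (t + 4 * (Re z)\<^sup>2) \<le> r\<^sup>2 * (s - 1)\<^sup>2"
    using assms by (intro mult_left_mono) (auto simp: Q_diag_eq s_def)
  moreover have "1 * t \<le> r\<^sup>2 * t" using assms by (intro mult_right_mono) auto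
  ultimately show ?thesis
    using assms by (simp add: Q_diag_eq power_mult_distrib s_def distrib_left)
qed

lemma Q_diag_at_unit_circle: "cmod z = 1 \<Longrightarrow> Q_diag z \<le> 0"
  by (simp add: Q_diag_eq)

text \<open>The unit circle lies in \<open>\<Omega> t\<close>, as Q \<le> 0 < t there, so no
  component of the complement crosses it. A component inside it is bounded, and one outside it
  contains a ray to infinity.\<close>

lemma hole_eq:
  assumes "0 < t"
  shows "hole t = {z. t \<le> Q_diag z \<and> cmod z < 1}"
proof (intro equalityI subsetI)
  fix z assume "z \<in> hole t"
  then have z: "t \<le> Q_diag z" and b: "bounded (connected_component_set (- \<Omega> t) z)"
    by (auto simp: hole_def inside_def \<Omega>_def)
  have "cmod z < 1"
  proof (rule ccontr)
    assume "\<not> cmod z < 1"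
    then have n: "1 \<le> cmod z" by simp
    have "(\<lambda>r. r *\<^sub>R z) ` {1..} \<subseteq> connected_component_set (- \<Omega> t) z"
    proof (rule connected_component_maximal)
      show "z \<in> (\<lambda>r. r *\<^sub>R z) ` {1..}" by (rule image_eqI[of _ _ 1]) auto
      show "connected ((\<lambda>r. r *\<^sub>R z) ` {1..})"
        by (intro connected_continuous_image continuous_intros) simp
      show "(\<lambda>r. r *\<^sub>R z) ` {1..} \<subseteq> - \<Omega> t"
        using Q_diag_expanding[OF _ z n] assms by (force simp: \<Omega>_def not_less)
    qed
    then have "bounded ((\<lambda>r. r *\<^sub>R z) ` {1..})" using b bounded_subset by blast
    then obtain B where B: "\<And>r. 1 \<le> r \<Longrightarrow> \<bar>r\<bar> * cmod z \<le> B" by (auto simp: bounded_iff)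
    have "\<bar>B\<bar> + 1 \<le> (\<bar>B\<bar> + 1) * cmod z" using n mult_left_mono[OF n, of "\<bar>B\<bar> + 1"] by simp
    then show False using B[of "\<bar>B\<bar> + 1"] by linarith
  qed
  then show "z \<in> {z. t \<le> Q_diag z \<and> cmod z < 1}" using z by simp
next
  fix z assume "z \<in> {z. t \<le> Q_diag z \<and> cmod z < 1}"
  then have z: "t \<le> Q_diag z" "cmod z < 1" by auto
  let ?C = "connected_component_set (- \<Omega> t) z"
  have "?C \<subseteq> cball 0 1"
  proof
    fix w assume w: "w \<in> ?C"
    show "w \<in> cball 0 1"
    proof (rule ccontr)
      assume "w \<notin> cball 0 1"
      moreover have "z \<in> ?C" using z by (simp add: \<Omega>_def)
      moreover have "connected (cmod ` ?C)"
        by (intro connected_continuous_image continuous_intros connected_connected_component)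
      ultimately have "1 \<in> cmod ` ?C"
        using z w connectedD_interval[of "cmod ` ?C" "cmod z" "cmod w" 1] by force
      then obtain u where "u \<in> ?C" "cmod u = 1" by auto
      moreover have "t \<le> Q_diag u"
        using \<open>u \<in> ?C\<close> connected_component_subset[of "- \<Omega> t" z] by (auto simp: \<Omega>_def not_less)
      ultimately show False using Q_diag_at_unit_circle[of u] assms by simp
    qed
  qed
  then have "bounded ?C" using bounded_cball bounded_subset by blast
  then show "z \<in> hole t" using z by (simp add: hole_def inside_def \<Omega>_def)
qed

lemma mem_balls_iff:
  "z \<in> ball 1 (sqrt 2) \<longleftrightarrow> (cmod z)\<^sup>2 - 1 < 2 * Re z"
  "z \<in> ball (- 1) (sqrt 2) \<longleftrightarrow> (cmod z)\<^sup>2 - 1 < - 2 * Re z"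
proof -
  have "z \<in> ball 1 (sqrt 2) \<longleftrightarrow> cmod (z - 1) < sqrt 2"
    by (simp add: dist_norm norm_minus_commute)
  also have "\<dots> \<longleftrightarrow> (cmod (z - 1))\<^sup>2 < 2"
    using real_sqrt_less_iff[of "(cmod (z - 1))\<^sup>2" 2] by simp
  finally show "z \<in> ball 1 (sqrt 2) \<longleftrightarrow> (cmod z)\<^sup>2 - 1 < 2 * Re z"
    unfolding cmod_power2 by (simp add: power2_eq_square algebra_simps)
  have "dist (- 1) z = cmod (z + 1)"
    by (metis add.commute diff_minus_eq_add dist_commute dist_norm)
  then have "z \<in> ball (- 1) (sqrt 2) \<longleftrightarrow> cmod (z + 1) < sqrt 2" by simp
  also have "\<dots> \<longleftrightarrow> (cmod (z + 1))\<^sup>2 < 2"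
    using real_sqrt_less_iff[of "(cmod (z + 1))\<^sup>2" 2] by simp
  finally show "z \<in> ball (- 1) (sqrt 2) \<longleftrightarrow> (cmod z)\<^sup>2 - 1 < - 2 * Re z"
    unfolding cmod_power2 by (simp add: power2_eq_square algebra_simps)
qed

lemma Q_diag_less_1:
  assumes "z \<noteq> 0" "cmod z < 1"
  shows "Q_diag z < 1"
proof -
  have "0 < (cmod z)\<^sup>2" "(cmod z)\<^sup>2 < 1"
    using assms by (auto simp: power_less_one_iff)
  then have "\<bar>(cmod z)\<^sup>2 - 1\<bar> < 1" by linarith
  then have "((cmod z)\<^sup>2 - 1)\<^sup>2 < 1" by (simp add: abs_square_less_1)
  then show ?thesis unfolding Q_diag_eq using zero_le_power2[of "Re z"] by linarith
qed

text \<open>A description of the zero set common to all three clauses of the density. The origin is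
  excluded because at \<open>t = 1\<close> its density is 0 although it lies in the unit
  disc.\<close>

lemma quad_density_eq_0_iff:
  assumes "0 \<le> t" "t \<le> 1" "z \<noteq> 0"
  shows "quad_density t z = 0 \<longleftrightarrow> t \<le> Q_diag z \<and> 1 \<le> cmod z"
proof -
  consider "t = 0" | "t = 1" | "0 < t" "t < 1" using assms by linarith
  then show ?thesis
  proof cases
    case 1
    define s where "s = (cmod z)\<^sup>2 - 1"
    have s: "1 \<le> cmod z \<longleftrightarrow> 0 \<le> s"
      using abs_square_less_1[of "cmod z"] by (simp add: s_def linorder_not_less[symmetric] del: abs_square_less_1)
    have "Q_diag z = (s - 2 * Re z) * (s + 2 * Re z)"
      by (simp add: Q_diag_eq s_def power2_eq_square algebra_simps)
    \<comment> \<open>The two factors have sum \<open>2 * s\<close>; product and sum are both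
      nonnegative exactly when both factors are.\<close>
    then have "0 \<le> Q_diag z \<and> 0 \<le> s \<longleftrightarrow> \<not> s < 2 * Re z \<and> \<not> s < - 2 * Re z"
      by (auto simp: zero_le_mult_iff)
    moreover have "quad_density t z = 0 \<longleftrightarrow> z \<notin> ball (- 1) (sqrt 2) \<and> z \<notin> ball 1 (sqrt 2)"
      using 1 by (simp add: quad_density_def indicator_def del: mem_ball)
    ultimately show ?thesis unfolding s 1 mem_balls_iff s_def by blast
  next
    case 2
    then show ?thesis
      using Q_diag_less_1[OF assms(3)]
      by (cases "cmod z < 1") (auto simp: quad_density_def \<Omega>_def not_less indicator_def)
  next
    case 3
    then show ?thesis by (auto simp: quad_density_def \<Omega>_def hole_eq)
  qed
qed

lemma borel_measurable_quad_density [measurable]: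
  assumes "0 \<le> t"
  shows "quad_density t \<in> borel_measurable borel"
proof -
  have Q[measurable]: "Q_diag \<in> borel_measurable borel"
    unfolding Q_diag_def[abs_def] by measurable
  have [measurable]: "\<Omega> t \<in> sets borel" for t
    unfolding \<Omega>_def by measurable
  have [measurable]: "hole t \<in> sets borel" if "t \<noteq> 0"
  proof -
    have "hole t = {z. t \<le> Q_diag z \<and> cmod z < 1}" using that assms by (intro hole_eq) simp
    then show ?thesis by simp measurable
  qed
  show ?thesis
  proof (cases "t = 0")
    case True
    then show ?thesis
      unfolding quad_density_def[abs_def] by (auto intro!: borel_measurable_add borel_measurable_indicator)
  next
    case False
    then show ?thesis unfolding quad_density_def[abs_def] by simp measurable
  qed
qed

lemma quad_density_bounds: "0 \<le> quad_density t z" "quad_density t z \<le> 2"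
  by (auto simp: quad_density_def indicator_def)

section \<open>Boundedness and starlikeness of the support\<close>

lemma cmod_le_3_if_Q_diag_less_1:
  assumes "Q_diag z < 1"
  shows "cmod z \<le> 3"
proof (rule ccontr)
  assume "\<not> cmod z \<le> 3"
  then have "3\<^sup>2 < (cmod z)\<^sup>2" by (intro power_strict_mono) auto
  \<comment> \<open>Bounding Re z by |z| gives Q - 1 \<ge> |z|^4 - 6 |z|^2; the radius 3 is a
    convenient one with |z|^2 > 6 beyond it.\<close>
  then have "0 \<le> (cmod z)\<^sup>2 * ((cmod z)\<^sup>2 - 6)" by (intro mult_nonneg_nonneg) auto
  moreover have "(Re z)\<^sup>2 \<le> (cmod z)\<^sup>2" by (simp add: cmod_power2)
  ultimately have "1 \<le> Q_diag z"
    unfolding Q_diag_eq by (simp add: power2_eq_square algebra_simps)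
  then show False using assms by simp
qed

lemma quad_density_support_bounded:
  assumes "0 \<le> t" "t \<le> 1"
  shows "support_on UNIV (quad_density t) \<subseteq> cball 0 3"
proof
  fix z assume z: "z \<in> support_on UNIV (quad_density t)"
  show "z \<in> cball 0 3"
  proof (cases "z = 0")
    case False
    then have "Q_diag z < t \<or> cmod z < 1"
      using quad_density_eq_0_iff[OF assms False] z by (auto simp: support_on_def not_le)
    then show ?thesis using cmod_le_3_if_Q_diag_less_1[of z] assms by auto
  qed simp
qed

lemma integrable_quad_density:
  assumes "0 \<le> t" "t \<le> 1"
  shows "integrable lborel (quad_density t)"
proof (rule Bochner_Integration.integrable_bound)
  show "integrable lborel (\<lambda>z::complex. 2 * indicator (cball 0 3) z :: real)"
    using emeasure_lborel_cball_finite[of "0::complex" 3]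
    by (intro integrable_mult_right integrable_real_indicator) auto
  show "AE z in lborel. norm (quad_density t z) \<le> norm (2 * indicator (cball 0 3) z :: real)"
  proof (rule AE_I2)
    fix z
    show "norm (quad_density t z) \<le> norm (2 * indicator (cball 0 3) z :: real)"
      using quad_density_bounds[of t z] quad_density_support_bounded[OF assms]
      by (cases "quad_density t z = 0") (auto simp: support_on_def subset_eq)
  qed
qed (use assms in simp)

lemma pm_1_in_support:
  assumes "0 \<le> t" "t \<le> 1"
  shows "1 \<in> support_on UNIV (quad_density t)" "- 1 \<in> support_on UNIV (quad_density t)"
proof -
  have "Q_diag 1 = - 4" "Q_diag (- 1) = - 4" by (simp_all add: Q_diag_eq)
  then show "1 \<in> support_on UNIV (quad_density t)" "- 1 \<in> support_on UNIV (quad_density t)"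
    using quad_density_eq_0_iff[OF assms, of 1] quad_density_eq_0_iff[OF assms, of "- 1"] assms
    by (simp_all add: support_on_def)
qed

text \<open>The contrapositive of expansion: if the shrunken point lay outside the support,
  stretching it by \<open>1 / r\<close> would put \<open>z\<close> outside as well.\<close>

lemma support_scaleR:
  assumes "0 \<le> t" "t \<le> 1" "z \<in> support_on UNIV (quad_density t)" "0 < r" "r \<le> 1"
  shows "r *\<^sub>R z \<in> support_on UNIV (quad_density t)"
proof (cases "z = 0")
  case False
  show ?thesis
  proof (rule ccontr)
    assume "r *\<^sub>R z \<notin> support_on UNIV (quad_density t)"
    then have rz: "t \<le> Q_diag (r *\<^sub>R z)" "1 \<le> cmod (r *\<^sub>R z)"
      using quad_density_eq_0_iff[OF assms(1,2), of "r *\<^sub>R z"] False assms by (auto simp: support_on_def)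
    have "t \<le> Q_diag ((1 / r) *\<^sub>R (r *\<^sub>R z))"
      using assms by (intro Q_diag_expanding rz) auto
    then have "t \<le> Q_diag z" using assms by simp
    moreover have "1 \<le> cmod z" using rz(2) assms mult_right_mono[OF assms(5), of "cmod z"] by simp
    ultimately show False
      using assms quad_density_eq_0_iff[OF assms(1,2) False] by (simp add: support_on_def)
  qed
qed (use assms in simp)

text \<open>The endpoint 0 is reached as a limit of points of the support on the positive real axis,
  because for \<open>t = 1\<close> it belongs only to the closure.\<close>

lemma closed_segment_in_closure_support:
  assumes "0 \<le> t" "t \<le> 1" "z \<in> closure (support_on UNIV (quad_density t))"
  shows "closed_segment 0 z \<subseteq> closure (support_on UNIV (quad_density t))"
proof
  let ?S = "support_on UNIV (quad_density t)"
  fix w assume "w \<in> closed_segment 0 z"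
  then obtain r where r: "0 \<le> r" "r \<le> 1" "w = r *\<^sub>R z" by (auto simp: closed_segment_def)
  show "w \<in> closure ?S"
  proof (cases "r = 0")
    case True
    have "(\<lambda>n. (1 / real (Suc n)) *\<^sub>R (1::complex)) \<longlonglongrightarrow> 0 *\<^sub>R 1"
      by (intro tendsto_intros LIMSEQ_Suc lim_1_over_n)
    moreover have "(1 / real (Suc n)) *\<^sub>R (1::complex) \<in> ?S" for n
      by (rule support_scaleR[OF assms(1,2) pm_1_in_support(1)[OF assms(1,2)]]) auto
    ultimately show ?thesis
      unfolding closure_sequential using True r by (intro exI[of _ "\<lambda>n. (1 / real (Suc n)) *\<^sub>R (1::complex)"]) auto
  next
    case False
    have "(*\<^sub>R) r ` closure ?S \<subseteq> closure ?S"
    proof (rule image_closure_subset)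
      show "(*\<^sub>R) r ` ?S \<subseteq> closure ?S"
        using support_scaleR[OF assms(1,2)] r False closure_subset by fastforce
    qed (auto intro!: continuous_intros)
    then show ?thesis using r assms by auto
  qed
qed

section \<open>The density along a line through the origin\<close>

text \<open>\<open>c + r\<close> and \<open>c - r\<close> are the roots s of s^2 - 2 c s + 1 - t,
  the restriction of Q - t to the line of slope \<open>v\<close> with s = |z|^2.\<close>

lemma line_roots:
  fixes t v :: real
  assumes t: "0 \<le> t" "t \<le> 1"
  defines "c \<equiv> 1 + 2 / (1 + v\<^sup>2)"
  defines "r \<equiv> sqrt (c\<^sup>2 - 1 + t)"
  shows "r\<^sup>2 = c\<^sup>2 - 1 + t" "0 < r" "0 \<le> c - r" "c - r < 1" "1 < c + r"
proof -
  have "0 < 1 + v\<^sup>2" by (simp add: add_pos_nonneg)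
  then have c: "1 < c" by (simp add: c_def)
  then have "1 < c\<^sup>2" by simp
  then show r2: "r\<^sup>2 = c\<^sup>2 - 1 + t" and r: "0 < r" using t by (simp_all add: r_def)
  have "(c + r) * (c - r) = 1 - t" using r2 by (simp add: power2_eq_square algebra_simps)
  then show "0 \<le> c - r"
    using t r c by (smt (verit) mult_pos_neg)
  show sp: "1 < c + r" using c r by simp
  \<comment> \<open>The left side is minus the quadratic at s = 1; positivity means that 1 separates
    the roots.\<close>
  have "(c + r - 1) * (1 - (c - r)) = 2 * (c - 1) + t"
    using r2 by (simp add: power2_eq_square algebra_simps)
  then have "0 < (c + r - 1) * (1 - (c - r))" using c t by simp
  then show "c - r < 1" using sp by (simp add: zero_less_mult_iff)
qed

text \<open>Between the roots the point lies in \<open>\<Omega> t\<close>; below the smaller root it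
  lies in the hole or the lens, where both indicators count. The boundary of the hole is left out:
  for 0 < t < 1 it has density 2, while the strict indicators add up to 1.\<close>

lemma quad_density_on_line:
  fixes t x v :: real
  assumes t: "0 \<le> t" "t \<le> 1"
  defines "c \<equiv> 1 + 2 / (1 + v\<^sup>2)"
  defines "r \<equiv> sqrt (c\<^sup>2 - 1 + t)"
  assumes x: "x \<noteq> 0" "x\<^sup>2 * (1 + v\<^sup>2) \<noteq> c - r"
  shows "quad_density t (x *\<^sub>R Complex 1 v)
     = indicator {x. x\<^sup>2 < (c + r) / (1 + v\<^sup>2)} x + indicator {x. x\<^sup>2 < (c - r) / (1 + v\<^sup>2)} x"
proof -
  define s where "s = x\<^sup>2 * (1 + v\<^sup>2)"
  define z where "z = x *\<^sub>R Complex 1 v"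
  have v: "0 < 1 + v\<^sup>2" by (simp add: add_pos_nonneg)
  have r2: "r\<^sup>2 = c\<^sup>2 - 1 + t" and r: "0 < r" and sm: "c - r < 1" and sp: "1 < c + r"
    unfolding c_def r_def by (rule line_roots[OF t])+
  then have prod: "(c + r) * (c - r) = 1 - t" by (simp add: power2_eq_square algebra_simps)
  have norm: "(cmod z)\<^sup>2 = s" by (simp add: z_def s_def cmod_power2 power_mult_distrib algebra_simps)
  have Re: "Re z = x" by (simp add: z_def)
  have "2 * c * s = 2 * s + 4 * x\<^sup>2"
  proof -
    have "2 / (1 + v\<^sup>2) * s = 2 * x\<^sup>2" using v by (simp add: s_def)
    then show ?thesis unfolding c_def by (simp only: distrib_left distrib_right mult_1_left)
  qed
  then have Q: "Q_diag z - t = (s - (c + r)) * (s - (c - r))"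
    using r2 unfolding Q_diag_eq norm Re by (simp add: power2_eq_square algebra_simps)
  have ind: "x\<^sup>2 < a / (1 + v\<^sup>2) \<longleftrightarrow> s < a" for a
    using v by (simp add: s_def pos_less_divide_eq)
  have s0: "0 < s" using x v by (simp add: s_def)
  have n1: "cmod z < 1 \<longleftrightarrow> s < 1"
    using norm abs_square_less_1[of "cmod z"] by simp
  have sne: "s \<noteq> c - r" using x by (simp add: s_def)
  have Qless: "Q_diag z < t \<longleftrightarrow> c - r < s \<and> s < c + r"
    using Q r sne by (smt (verit) mult_pos_neg mult_neg_pos mult_pos_pos mult_neg_neg mult_eq_0_iff)
  have "quad_density t z = indicator {s. s < c + r} s + indicator {s. s < c - r} s"
  proof -
    consider "t = 0" | "t = 1" | "0 < t" "t < 1" using t by linarith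
    then show ?thesis
    proof cases
      case 1
      have prodQ: "Q_diag z = (s - 1 - 2 * x) * (s - 1 + 2 * x)"
        unfolding Q_diag_eq norm Re by (simp add: power2_eq_square algebra_simps)
      have dens: "quad_density t z = indicator {y. s - 1 < - 2 * y} x + indicator {y. s - 1 < 2 * y} x"
        using 1 unfolding quad_density_def indicator_def mem_balls_iff norm Re by (simp del: mem_ball)
      consider "s < c - r" | "c - r < s" "s < c + r" | "c + r \<le> s" using sne by linarith
      then show ?thesis
      proof cases
        case 1
        \<comment> \<open>The factors have equal sign and their sum \<open>2 * (s - 1)\<close> is
          negative, so the point is in both discs.\<close>
        have "0 < (s - 1 - 2 * x) * (s - 1 + 2 * x)"
          using Q 1 r prodQ \<open>t = 0\<close> by (smt (verit) mult_neg_neg)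
        then have "s - 1 < - 2 * x" "s - 1 < 2 * x" using 1 sm by (auto simp: zero_less_mult_iff)
        then show ?thesis using 1 r by (simp add: dens)
      next
        case 2
        \<comment> \<open>Opposite signs of the factors mean that the point is in exactly one
          disc.\<close>
        have "(s - 1 - 2 * x) * (s - 1 + 2 * x) < 0"
          using Qless 2 prodQ \<open>t = 0\<close> by simp
        then show ?thesis using 2 by (auto simp: dens mult_less_0_iff indicator_def)
      next
        case 3
        have "0 \<le> (s - 1 - 2 * x) * (s - 1 + 2 * x)"
          using Qless 3 prodQ \<open>t = 0\<close> by linarith
        then have "\<not> s - 1 < - 2 * x" "\<not> s - 1 < 2 * x" using 3 sp by (auto simp: zero_le_mult_iff)
        then show ?thesis using 3 r by (simp add: dens)
      qed
    next
      case 2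
      then have "c - r = 0" using prod sp by auto
      then show ?thesis using 2 Qless s0 by (auto simp: quad_density_def \<Omega>_def indicator_def)
    next
      case 3
      then show ?thesis
        using Qless n1 sne sp sm by (auto simp: quad_density_def \<Omega>_def hole_eq indicator_def)
    qed
  qed
  then show "quad_density t (x *\<^sub>R Complex 1 v)
     = indicator {x. x\<^sup>2 < (c + r) / (1 + v\<^sup>2)} x + indicator {x. x\<^sup>2 < (c - r) / (1 + v\<^sup>2)} x"
    by (simp add: ind indicator_def flip: z_def)
qed

subsection \<open>The moments and the quadrature identity\<close>

text \<open>For n = 2m the two intervals contribute the (m+1)-st power sum of the roots divided by
  w^(m+1), where w = 1 + v^2, and (1 + iv)^n = E^m w^m. One factor 1/w remains, which is the weight
  of the angular measure.\<close>

lemma quad_density_line_integral: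
  fixes t v :: real
  assumes t: "0 \<le> t" "t \<le> 1"
  shows "(LBINT x. \<bar>x\<bar> *\<^sub>R ((x *\<^sub>R Complex 1 v) ^ n * of_real (quad_density t (x *\<^sub>R Complex 1 v))))
     = (if even n then poly (power_sum_poly (of_real (1 - t)) (n div 2 + 1)) (cayley v) / cayley v
           / of_real (1 + v\<^sup>2) / of_nat (n div 2 + 1) else 0)"
proof -
  define c where "c = 1 + 2 / (1 + v\<^sup>2)"
  define r where "r = sqrt (c\<^sup>2 - 1 + t)"
  define w where "w = 1 + v\<^sup>2"
  define X where "X = (c + r) / w"
  define Y where "Y = (c - r) / w"
  have w: "0 < w" by (simp add: w_def add_pos_nonneg)
  have r2: "r\<^sup>2 = c\<^sup>2 - 1 + t" and r: "0 < r" and cr: "0 \<le> c - r"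
    unfolding c_def r_def by (rule line_roots[OF t])+
  have X: "0 \<le> X" and Y: "0 \<le> Y" using cr r w by (auto simp: X_def Y_def)
  let ?I = "\<lambda>X. if even n then 2 * sqrt X ^ (n + 2) / (n + 2) else 0 :: real"
  have line: "has_bochner_integral lborel
      (\<lambda>x. \<bar>x\<bar> * x ^ n * indicator {x. x\<^sup>2 < X} x + \<bar>x\<bar> * x ^ n * indicator {x. x\<^sup>2 < Y} x) (?I X + ?I Y)"
    by (intro has_bochner_integral_add has_bochner_integral_abs_mult_power X Y)
  from has_bochner_integral_mult_right[OF has_bochner_integral_of_real[OF this, where 'a = complex], of "Complex 1 v ^ n"]
  have "has_bochner_integral lborel
      (\<lambda>x. Complex 1 v ^ n * of_real (\<bar>x\<bar> * x ^ n * indicator {x. x\<^sup>2 < X} x + \<bar>x\<bar> * x ^ n * indicator {x. x\<^sup>2 < Y} x))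
      (Complex 1 v ^ n * of_real (?I X + ?I Y))" by simp
  then have int: "(LBINT x. Complex 1 v ^ n * of_real (\<bar>x\<bar> * x ^ n * indicator {x. x\<^sup>2 < X} x + \<bar>x\<bar> * x ^ n * indicator {x. x\<^sup>2 < Y} x))
     = Complex 1 v ^ n * of_real (?I X + ?I Y)"
    by (rule has_bochner_integral_integral_eq)
  have "(LBINT x. \<bar>x\<bar> *\<^sub>R ((x *\<^sub>R Complex 1 v) ^ n * of_real (quad_density t (x *\<^sub>R Complex 1 v))))
      = (LBINT x. Complex 1 v ^ n * of_real (\<bar>x\<bar> * x ^ n * indicator {x. x\<^sup>2 < X} x + \<bar>x\<bar> * x ^ n * indicator {x. x\<^sup>2 < Y} x))"
  proof (rule integral_cong_AE)
    have [measurable]: "(\<lambda>x. x *\<^sub>R Complex 1 v) \<in> borel_measurable borel" by measurable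
    have [measurable]: "quad_density t \<in> borel_measurable borel" using t by simp
    show "(\<lambda>x. \<bar>x\<bar> *\<^sub>R ((x *\<^sub>R Complex 1 v) ^ n * of_real (quad_density t (x *\<^sub>R Complex 1 v)))) \<in> borel_measurable lborel"
      by measurable
    show "(\<lambda>x. Complex 1 v ^ n * of_real (\<bar>x\<bar> * x ^ n * indicator {x. x\<^sup>2 < X} x + \<bar>x\<bar> * x ^ n * indicator {x. x\<^sup>2 < Y} x)) \<in> borel_measurable lborel"
      by measurable
    show "AE x in lborel. \<bar>x\<bar> *\<^sub>R ((x *\<^sub>R Complex 1 v) ^ n * of_real (quad_density t (x *\<^sub>R Complex 1 v)))
       = Complex 1 v ^ n * of_real (\<bar>x\<bar> * x ^ n * indicator {x. x\<^sup>2 < X} x + \<bar>x\<bar> * x ^ n * indicator {x. x\<^sup>2 < Y} x)"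
      using AE_lborel_singleton[of 0] AE_lborel_singleton[of "sqrt Y"] AE_lborel_singleton[of "- sqrt Y"]
    proof eventually_elim
      fix x :: real assume x: "x \<noteq> 0" "x \<noteq> sqrt Y" "x \<noteq> - sqrt Y"
      have "x\<^sup>2 * (1 + v\<^sup>2) \<noteq> c - r"
      proof
        assume "x\<^sup>2 * (1 + v\<^sup>2) = c - r"
        then have "x\<^sup>2 = Y" using w by (simp add: Y_def w_def field_simps)
        then have "sqrt Y = \<bar>x\<bar>" by (metis real_sqrt_abs)
        then show False using x by auto
      qed
      then have "quad_density t (x *\<^sub>R Complex 1 v) = indicator {x. x\<^sup>2 < X} x + indicator {x. x\<^sup>2 < Y} x"
        using quad_density_on_line[OF t x(1), of v] unfolding X_def Y_def c_def r_def w_def by simp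
      then show "\<bar>x\<bar> *\<^sub>R ((x *\<^sub>R Complex 1 v) ^ n * of_real (quad_density t (x *\<^sub>R Complex 1 v)))
       = Complex 1 v ^ n * of_real (\<bar>x\<bar> * x ^ n * indicator {x. x\<^sup>2 < X} x + \<bar>x\<bar> * x ^ n * indicator {x. x\<^sup>2 < Y} x)"
        by (simp only: scaleR_conv_of_real power_mult_distrib of_real_add of_real_mult of_real_power)
           (simp add: algebra_simps)
    qed
  qed
  also note int
  also have "Complex 1 v ^ n * of_real (?I X + ?I Y) =
      (if even n then poly (power_sum_poly (of_real (1 - t)) (n div 2 + 1)) (cayley v) / cayley v
           / of_real (1 + v\<^sup>2) / of_nat (n div 2 + 1) else 0)"
  proof (cases "even n")
    case False
    then show ?thesis by simp
  next
    case True
    then obtain m where n: "n = 2 * m" by (elim evenE)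
    let ?E = "cayley v"
    have wc: "(of_real w :: complex) \<noteq> 0" using w by simp
    have sq: "2 * sqrt Z ^ (n + 2) / (n + 2) = Z ^ Suc m / Suc m" if "0 \<le> Z" for Z
    proof -
      have "sqrt Z ^ (n + 2) = (sqrt Z ^ 2) ^ Suc m"
        unfolding n power_mult[symmetric] by (simp add: mult.commute)
      also have "\<dots> = Z ^ Suc m" using that by simp
      finally have "sqrt Z ^ (n + 2) = Z ^ Suc m" .
      moreover have "real (n + 2) = 2 * real (Suc m)" by (simp add: n)
      ultimately show ?thesis by (simp only: mult_divide_mult_cancel_left zero_neq_numeral[symmetric] not_False_eq_True)
    qed
    have "?I X + ?I Y = X ^ Suc m / Suc m + Y ^ Suc m / Suc m"
      unfolding if_P[OF True] sq[OF X] sq[OF Y] by (rule refl)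
    moreover have "X ^ Suc m = (c + r) ^ Suc m / w ^ Suc m" "Y ^ Suc m = (c - r) ^ Suc m / w ^ Suc m"
      by (simp_all only: X_def Y_def power_divide)
    ultimately have "?I X + ?I Y = ((c + r) ^ Suc m + (c - r) ^ Suc m) / w ^ Suc m / Suc m"
      by (simp only: add_divide_distrib)
    moreover have "Complex 1 v ^ n = ?E ^ m * of_real w ^ m"
      using wc unfolding n power_mult cayley_eq w_def[symmetric] by (simp add: power_divide)
    ultimately have "Complex 1 v ^ n * of_real (?I X + ?I Y)
        = ?E ^ m * of_real w ^ m * of_real (((c + r) ^ Suc m + (c - r) ^ Suc m) / w ^ Suc m / Suc m)" by (simp only:)
    also have "\<dots> = ?E ^ m * (of_real (c + r) ^ Suc m + of_real (c - r) ^ Suc m) / of_real w / of_nat (Suc m)"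
      using wc by (simp del: of_nat_Suc add: field_simps)
    also have "?E ^ m = ?E ^ Suc m / ?E" using cayley_nonzero by simp
    also have "?E ^ Suc m / ?E * (of_real (c + r) ^ Suc m + of_real (c - r) ^ Suc m)
       = poly (power_sum_poly (of_real (1 - t)) (Suc m)) ?E / ?E"
    proof -
      \<comment> \<open>This is the source of the middle coefficient 4 in
        \<open>power_sum_poly\<close>.\<close>
      have "2 * c = 4 + 2 * ((1 - v\<^sup>2) / (1 + v\<^sup>2))"
        using w by (simp add: c_def w_def field_simps)
      then have "of_real (2 * c) = 4 + (?E + inverse ?E)"
        unfolding cayley_plus_inverse by (simp only: of_real_add of_real_numeral)
      then have "?E * (of_real (c + r) + of_real (c - r)) = 1 + 4 * ?E + ?E\<^sup>2"
        using cayley_nonzero[of v] by (simp add: algebra_simps power2_eq_square)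
      moreover have "(c + r) * (c - r) = 1 - t" using r2 by (simp add: power2_eq_square algebra_simps)
      then have "of_real (c + r) * of_real (c - r) = (of_real (1 - t) :: complex)"
        by (simp only: of_real_mult[symmetric])
      ultimately show ?thesis by (simp only: poly_power_sum_poly times_divide_eq_left)
    qed
    finally show ?thesis using True by (simp add: n w_def)
  qed
  finally show ?thesis .
qed

text \<open>For even n and k = n/2 + 1 the relevant coefficient is 4k, and the radial integration
  divides by k; the result 4\<pi> is the sum of the two point masses 2\<pi>.\<close>

lemma quad_density_moments:
  fixes t :: real
  assumes t: "0 \<le> t" "t \<le> 1"
  shows "(LINT z|lborel. z ^ n * of_real (quad_density t z)) = (\<Sum>a\<in>{1, - 1}. 2 * of_real pi * a ^ n)"
proof -
  have "integrable lborel (\<lambda>z. z ^ n * complex_of_real (quad_density t z))"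
    using quad_density_support_bounded[OF t] integrable_quad_density[OF t]
    by (intro integrable_continuous_on_mult[of "cball 0 3"] continuous_intros integrable_of_real)
       (auto simp: support_on_def)
  then have "(LINT z|lborel. z ^ n * complex_of_real (quad_density t z))
     = (LBINT v. LBINT x. \<bar>x\<bar> *\<^sub>R ((x *\<^sub>R Complex 1 v) ^ n * of_real (quad_density t (x *\<^sub>R Complex 1 v))))"
    by (rule integral_over_lines_through_origin)
  also have "\<dots> = (if even n then 4 * of_real pi else 0)"
  proof (cases "even n")
    case True
    let ?p = "power_sum_poly (of_real (1 - t)) (n div 2 + 1)"
    have "has_bochner_integral lborel (\<lambda>v. poly ?p (cayley v) / cayley v / of_real (1 + v\<^sup>2) / of_nat (n div 2 + 1))
       (of_real pi * coeff ?p 1 / of_nat (n div 2 + 1))"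
      by (intro has_bochner_integral_divide has_bochner_integral_poly_cayley) 
    moreover have "of_real pi * coeff ?p 1 / of_nat (n div 2 + 1) = 4 * of_real pi"
      using coeff_power_sum_poly[of "of_real (1 - t)" "n div 2"] by (simp del: of_nat_Suc)
    ultimately show ?thesis
      using True unfolding quad_density_line_integral[OF t] by (simp add: has_bochner_integral_integral_eq)
  next
    case False
    then show ?thesis unfolding quad_density_line_integral[OF t] by simp
  qed
  also have "\<dots> = (\<Sum>a\<in>{1, - 1}. 2 * of_real pi * a ^ n)"
    by (simp add: complex_eq_iff)
  finally show ?thesis .
qed

section \<open>From holomorphic to harmonic test functions\<close>

text \<open>The neighbourhood \<open>U\<close> given with \<open>h\<close> need not be starlike.
  This set is its largest part starlike about 0, and it still contains the closed support.\<close>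

lemma open_segments_from_0_into:
  fixes U :: "'a::real_normed_vector set"
  assumes "open U"
  shows "open {z. closed_segment 0 z \<subseteq> U}"
  unfolding open_contains_ball
proof
  fix z assume "z \<in> {z. closed_segment 0 z \<subseteq> U}"
  then obtain e where e: "e > 0" "(\<Union>x\<in>closed_segment 0 z. ball x e) \<subseteq> U"
    using compact_subset_open_imp_ball_epsilon_subset[of "closed_segment 0 z" U] assms by auto
  have "ball z e \<subseteq> {z. closed_segment 0 z \<subseteq> U}"
  proof (intro subsetI CollectI)
    fix y x assume y: "y \<in> ball z e" and "x \<in> closed_segment 0 y"
    then obtain u where u: "0 \<le> u" "u \<le> 1" "x = u *\<^sub>R y" by (auto simp: closed_segment_def)
    have "dist (u *\<^sub>R z) x = u * dist z y"
      using u by (simp add: dist_norm flip: scaleR_right_diff_distrib)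
    also have "\<dots> \<le> dist z y" using u by (simp add: mult_left_le_one_le)
    finally have "x \<in> ball (u *\<^sub>R z) e" using y by simp
    moreover have "u *\<^sub>R z \<in> closed_segment 0 z" using u by (auto simp: closed_segment_def)
    ultimately show "x \<in> U" using e(2) by blast
  qed
  then show "\<exists>e>0. ball z e \<subseteq> {z. closed_segment 0 z \<subseteq> U}" using e(1) by blast
qed

text \<open>The Wirtinger derivative \<open>p\<close> of \<open>h\<close> is holomorphic because the
  Laplacian vanishes. It has a primitive \<open>F\<close> on the starlike set, and
  \<open>h - F\<close> has Wirtinger derivative 0, so its conjugate is holomorphic.\<close>

lemma harmonic_on_starlike_decomposition:
  fixes h :: "complex \<Rightarrow> complex"
  assumes h: "harmonic_on h U" and V: "open V" "starlike V" "V \<subseteq> U"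
  obtains F G where "F holomorphic_on V" "G holomorphic_on V" "\<And>z. z \<in> V \<Longrightarrow> h z = F z + cnj (G z)"
proof -
  obtain h' :: "complex \<Rightarrow> complex \<Rightarrow>\<^sub>L complex" and h'' where U: "open U"
    and h': "\<And>z. z \<in> U \<Longrightarrow> (h has_derivative blinfun_apply (h' z)) (at z)"
    and h'': "\<And>z. z \<in> U \<Longrightarrow> (h' has_derivative blinfun_apply (h'' z)) (at z)"
    and lap: "\<And>z. z \<in> U \<Longrightarrow> blinfun_apply (blinfun_apply (h'' z) 1) 1 + blinfun_apply (blinfun_apply (h'' z) \<i>) \<i> = 0"
    using h unfolding harmonic_on_def by blast
  define p where "p = (\<lambda>z. (h' z 1 - \<i> * h' z \<i>) / 2)"
  have expand: "blinfun_apply f w = of_real (Re w) * f 1 + of_real (Im w) * f \<i>" for f :: "complex \<Rightarrow>\<^sub>L complex" and w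
  proof -
    have "w = Re w *\<^sub>R 1 + Im w *\<^sub>R \<i>" by (simp add: complex_eq_iff)
    then have "blinfun_apply f w = blinfun_apply f (Re w *\<^sub>R 1 + Im w *\<^sub>R \<i>)"
      by (rule arg_cong)
    also have "\<dots> = Re w *\<^sub>R f 1 + Im w *\<^sub>R f \<i>" by (simp only: blinfun.add_right blinfun.scaleR_right)
    finally show ?thesis by (simp only: scaleR_conv_of_real)
  qed
  have p: "(p has_field_derivative (h'' z 1 1 - \<i> * h'' z 1 \<i>) / 2) (at z)" if z: "z \<in> U" for z
  proof -
    have d: "(p has_derivative (\<lambda>w. (h'' z w 1 - \<i> * h'' z w \<i>) / 2)) (at z)"
      unfolding p_def by (auto intro!: derivative_eq_intros h''[OF z] simp: blinfun.bilinear_simps)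
    have eq: "(h'' z w 1 - \<i> * h'' z w \<i>) / 2 = (h'' z 1 1 - \<i> * h'' z 1 \<i>) / 2 * w" for w
    proof -
      have sym: "h'' z a b = h'' z b a" for a b
        by (rule second_derivative_symmetric[OF U z h' h''[OF z]])
      \<comment> \<open>Together with the symmetry this makes the real derivative of
        \<open>p\<close> complex linear.\<close>
      have "h'' z \<i> \<i> = - h'' z 1 1" using lap[OF z] by (simp add: eq_neg_iff_add_eq_0 add.commute)
      then have e: "h'' z w 1 = of_real (Re w) * h'' z 1 1 + of_real (Im w) * h'' z 1 \<i>"
        "h'' z w \<i> = of_real (Re w) * h'' z 1 \<i> - of_real (Im w) * h'' z 1 1"
        by (simp_all only: sym[of w] expand[of _ w] sym[of \<i> 1] mult_minus_right add_uminus_conv_diff)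
      have ii: "\<i> * (\<i> * x) = - x" for x by (simp flip: mult.assoc)
      have gen: "a * A + b * B - \<i> * (a * B - b * A) = (A - \<i> * B) * (a + \<i> * b)" for A B a b :: complex
        by (simp add: algebra_simps ii)
      have "of_real (Re w) + \<i> * of_real (Im w) = w" by (simp add: complex_eq_iff)
      then show ?thesis by (simp only: e gen times_divide_eq_left)
    qed
    show ?thesis
      unfolding has_field_derivative_def by (rule has_derivative_eq_rhs[OF d], rule ext, rule eq)
  qed
  have "\<exists>F. \<forall>z\<in>V. (F has_field_derivative p z) (at z)"
  proof (rule holomorphic_starlike_primitive[OF _ V(2,1), of _ "{}"])
    show "continuous_on V p"
      using p V by (auto intro!: continuous_at_imp_continuous_on DERIV_isCont)
    show "\<And>z. z \<in> V - {} \<Longrightarrow> p field_differentiable at z"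
      using p V by (auto simp: field_differentiable_def)
  qed simp
  then obtain F where F: "\<And>z. z \<in> V \<Longrightarrow> (F has_field_derivative p z) (at z)" by blast
  define G where "G = (\<lambda>z. cnj (h z - F z))"
  have G: "(G has_field_derivative cnj ((h' z 1 + \<i> * h' z \<i>) / 2)) (at z)" if z: "z \<in> V" for z
  proof -
    have "(h has_derivative h' z) (at z)" using h' z V by blast
    moreover have "(F has_derivative (*) (p z)) (at z)" using F[OF z] by (rule has_field_derivative_imp_has_derivative)
    ultimately have d: "(G has_derivative (\<lambda>w. cnj (h' z w - p z * w))) (at z)"
      unfolding G_def by (intro has_derivative_cnj has_derivative_diff)
    \<comment> \<open>A real linear map is \<open>p z * w + q * cnj w\<close> with
      \<open>q = (h' z 1 + \<i> * h' z \<i>) / 2\<close>; only the conjugate-linear part is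
      left.\<close>
    have eq: "cnj (h' z w - p z * w) = cnj ((h' z 1 + \<i> * h' z \<i>) / 2) * w" for w
      unfolding p_def expand[of "h' z" w] by (simp add: complex_eq_iff field_simps)
    show ?thesis
      unfolding has_field_derivative_def by (rule has_derivative_eq_rhs[OF d], rule ext, rule eq)
  qed
  show thesis
  proof (rule that[of F G])
    show "F holomorphic_on V" "G holomorphic_on V"
      using F G V by (auto simp: holomorphic_on_open)
  qed (simp add: G_def)
qed

theorem proposition7p1:
  fixes t :: real and h :: "complex \<Rightarrow> complex" and U :: "complex set"
  assumes "0 \<le> t" and "t \<le> 1"
    and "harmonic_on h U" and "closure (support_on UNIV (quad_density t)) \<subseteq> U"
  shows "has_bochner_integral lborel (\<lambda>z. h z * complex_of_real (quad_density t z))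
           (2 * complex_of_real pi * (h (- 1) + h 1))"
proof -
  note t = assms(1,2)
  let ?S = "support_on UNIV (quad_density t)"
  define K where "K = closure ?S"
  define V where "V = {z. closed_segment 0 z \<subseteq> U}"
  let ?g = "\<lambda>z. complex_of_real (quad_density t z)"
  have K: "compact K"
    unfolding K_def compact_closure using quad_density_support_bounded[OF t] bounded_cball bounded_subset by blast
  have g0: "?g z = 0" if "z \<notin> K" for z
    using that closure_subset[of ?S] by (auto simp: K_def support_on_def)
  have int_g: "integrable lborel ?g" using integrable_quad_density[OF t] by (rule integrable_of_real)
  have pm1: "1 \<in> K" "- 1 \<in> K"
    using pm_1_in_support[OF t] closure_subset[of ?S] by (auto simp: K_def)
  have "open V" unfolding V_def using assms(3) by (intro open_segments_from_0_into) (simp add: harmonic_on_def)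
  have "V \<subseteq> U" by (auto simp: V_def)
  have KV: "K \<subseteq> V"
    using closed_segment_in_closure_support[OF t] assms(4) unfolding V_def K_def by blast
  have seg: "closed_segment 0 z \<subseteq> V" if "z \<in> V" for z
    using that subset_closed_segment[of 0 _ 0 z] unfolding V_def by fastforce
  have "starlike V" using seg KV pm1 unfolding starlike_def by (metis ends_in_segment(1) subset_iff)
  then obtain F G where F: "F holomorphic_on V" and G: "G holomorphic_on V"
    and h: "\<And>z. z \<in> V \<Longrightarrow> h z = F z + cnj (G z)"
    using harmonic_on_starlike_decomposition[OF assms(3) \<open>open V\<close> _ \<open>V \<subseteq> U\<close>] by metis
  have quad: "has_bochner_integral lborel (\<lambda>z. f z * ?g z) (2 * of_real pi * (f (- 1) + f 1))"
    if f: "f holomorphic_on V" for f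
  proof -
    have "integrable lborel (\<lambda>z. f z * ?g z)"
      using f KV by (intro integrable_continuous_on_mult[OF K _ int_g g0])
        (auto intro: holomorphic_on_imp_continuous_on continuous_on_subset)
    moreover have "(LINT z|lborel. f z * ?g z) = (\<Sum>a\<in>{1, - 1}. 2 * of_real pi * f a)"
      by (rule quadrature_from_moments[OF K int_g g0 _ _ \<open>open V\<close> KV seg f quad_density_moments[OF t]])
         (use pm1 in auto)
    ultimately show ?thesis
      by (simp add: has_bochner_integral_iff complex_eq_iff algebra_simps)
  qed
  \<comment> \<open>Conjugation passes through the identity for \<open>G\<close> because the density
    and the weights 2\<pi> are real.\<close>
  have "has_bochner_integral lborel (\<lambda>z. F z * ?g z + cnj (G z * ?g z))
      (2 * of_real pi * (F (- 1) + F 1) + cnj (2 * of_real pi * (G (- 1) + G 1)))"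
    by (intro has_bochner_integral_add quad F has_bochner_integral_bounded_linear[OF bounded_linear_cnj] quad G)
  moreover have "F z * ?g z + cnj (G z * ?g z) = h z * ?g z" for z
    using h[of z] KV g0[of z] by (cases "z \<in> K") (auto simp: algebra_simps)
  moreover have "2 * of_real pi * (F (- 1) + F 1) + cnj (2 * of_real pi * (G (- 1) + G 1)) = 2 * of_real pi * (h (- 1) + h 1)"
  proof -
    have h1: "h 1 = F 1 + cnj (G 1)" "h (- 1) = F (- 1) + cnj (G (- 1))"
      using pm1 KV by (intro h; blast)+
    show ?thesis unfolding h1 by (simp add: algebra_simps)
  qed
  ultimately show ?thesis by simp
qed

end
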